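(* Assume the OMv conjecture. Then for every constant $\epsilon>0$ there does not exist an incremental fully retroactive data structure for maintaining the maximum degree of a graph with $O(n^{1-\epsilon})$ update and query time subject to operations $\textsf{Create}(\textsf{Insert}(e),t)$ and $\textsf{Query}(t)$, even when edges are unweighted.
   Context: Setting: a graph on a fixed vertex set with $n$ vertices, initially empty. The data structure maintains a set of edge insertions, each with a distinct real time. $\textsf{Create}(\textsf{Insert}(e),t)$ inserts edge $e$ at time $t$; $\textsf{Query}(t)$ returns the maximum degree of the graph $G_t$ consisting of the edges whose insertion time is at most $t$. OMv problem: given an $n\times n$ Boolean matrix $M$, then $n$ Boolean vectors $v_1,\dots,v_n$ arriving online, output the Boolean product $Mv_i$ before $v_{i+1}$ is revealed. OMv conjecture: for every constant $\epsilon>0$ no algorithm solves OMv in $O(n^{3-\epsilon})$ time. *)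

theory Defs
  imports Complex_Main "HOL-Library.Landau_Symbols"
begin

section \<open>Word RAM with real-valued time stamps\<close>

text \<open>
  Algorithms are fixed (uniform) programs for a unit-cost word RAM with registers, a random-access
  memory of words and the usual word instructions. In addition there are cells holding reals, in
  which time stamps are passed. Reals can be copied, compared, rounded down to a word and made from
  a word; there is no arithmetic on them, since unit-cost arithmetic on unbounded numbers would
  pack vectors into single cells. A program that gets no real input only ever holds words in its
  real cells, so for such programs this is the ordinary word RAM.

  Control flow is structured; a program with jumps is simulated with constant-factor overhead
  by a loop that dispatches on a program counter.
\<close>

datatype arith = Add | Sub | Mul | Div | Mod | And | Or | Xor | Shl | Shr | Less

fun arith_sem :: "arith \<Rightarrow> nat \<Rightarrow> nat \<Rightarrow> nat" where
  "arith_sem Add x y = x + y"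
| "arith_sem Sub x y = x - y"
| "arith_sem Mul x y = x * y"
| "arith_sem Div x y = x div y"
| "arith_sem Mod x y = x mod y"
| "arith_sem And x y = Bit_Operations.and x y"
| "arith_sem Or x y = Bit_Operations.or x y"
| "arith_sem Xor x y = Bit_Operations.xor x y"
| "arith_sem Shl x y = push_bit y x"
| "arith_sem Shr x y = drop_bit y x"
| "arith_sem Less x y = of_bool (x < y)"

datatype com =
    Const nat nat              \<comment> \<open>\<open>reg a := c\<close>\<close>
  | Arith arith nat nat nat    \<comment> \<open>\<open>reg a := reg b \<circ> reg c\<close>\<close>
  | Load nat nat               \<comment> \<open>\<open>reg a := mem (reg b)\<close>\<close>
  | Store nat nat              \<comment> \<open>\<open>mem (reg a) := reg b\<close>\<close>
  | RMove nat nat              \<comment> \<open>\<open>rreg a := rreg b\<close>\<close>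
  | RLoad nat nat              \<comment> \<open>\<open>rreg a := rmem (reg b)\<close>\<close>
  | RStore nat nat             \<comment> \<open>\<open>rmem (reg a) := rreg b\<close>\<close>
  | RLess nat nat nat          \<comment> \<open>\<open>reg a := [rreg b < rreg c]\<close>\<close>
  | ROfWord nat nat            \<comment> \<open>\<open>rreg a := real (reg b)\<close>\<close>
  | RFloor nat nat             \<comment> \<open>\<open>reg a := \<lfloor>rreg b\<rfloor>\<close>\<close>
  | Seq com com
  | Cond nat com com           \<comment> \<open>first branch iff \<open>reg a \<noteq> 0\<close>\<close>
  | While nat com              \<comment> \<open>loop as long as \<open>reg a \<noteq> 0\<close>\<close>

record state =
  reg :: "nat \<Rightarrow> nat"
  mem :: "nat \<Rightarrow> nat"
  rreg :: "nat \<Rightarrow> real"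
  rmem :: "nat \<Rightarrow> real"

abbreviation set_reg :: "nat \<Rightarrow> nat \<Rightarrow> state \<Rightarrow> state" where
  "set_reg a x s \<equiv> s\<lparr>reg := (reg s)(a := x)\<rparr>"

abbreviation set_rreg :: "nat \<Rightarrow> real \<Rightarrow> state \<Rightarrow> state" where
  "set_rreg a x s \<equiv> s\<lparr>rreg := (rreg s)(a := x)\<rparr>"

text \<open>
  \<open>exec B c s t s'\<close>: with words ranging over \<open>{0..<B}\<close>, program \<open>c\<close> leads from \<open>s\<close> to \<open>s'\<close> in
  exactly \<open>t\<close> steps. Producing a value that is not a word is an error: such a run has no derivation.
\<close>

inductive exec :: "nat \<Rightarrow> com \<Rightarrow> state \<Rightarrow> nat \<Rightarrow> state \<Rightarrow> bool" for B :: nat where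
  Const: "x < B \<Longrightarrow> exec B (Const a x) s 1 (set_reg a x s)"
| Arith: "arith_sem f (reg s b) (reg s c) < B \<Longrightarrow>
    exec B (Arith f a b c) s 1 (set_reg a (arith_sem f (reg s b) (reg s c)) s)"
| Load: "exec B (Load a b) s 1 (set_reg a (mem s (reg s b)) s)"
| Store: "exec B (Store a b) s 1 (s\<lparr>mem := (mem s)(reg s a := reg s b)\<rparr>)"
| RMove: "exec B (RMove a b) s 1 (set_rreg a (rreg s b) s)"
| RLoad: "exec B (RLoad a b) s 1 (set_rreg a (rmem s (reg s b)) s)"
| RStore: "exec B (RStore a b) s 1 (s\<lparr>rmem := (rmem s)(reg s a := rreg s b)\<rparr>)"
| RLess: "exec B (RLess a b c) s 1 (set_reg a (of_bool (rreg s b < rreg s c)) s)"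
| ROfWord: "exec B (ROfWord a b) s 1 (set_rreg a (real (reg s b)) s)"
| RFloor: "0 \<le> rreg s b \<Longrightarrow> nat \<lfloor>rreg s b\<rfloor> < B \<Longrightarrow>
    exec B (RFloor a b) s 1 (set_reg a (nat \<lfloor>rreg s b\<rfloor>) s)"
| Seq: "exec B c1 s t1 s1 \<Longrightarrow> exec B c2 s1 t2 s2 \<Longrightarrow> exec B (Seq c1 c2) s (t1 + t2) s2"
| CondTrue: "reg s a \<noteq> 0 \<Longrightarrow> exec B c1 s t s' \<Longrightarrow> exec B (Cond a c1 c2) s (Suc t) s'"
| CondFalse: "reg s a = 0 \<Longrightarrow> exec B c2 s t s' \<Longrightarrow> exec B (Cond a c1 c2) s (Suc t) s'"
| WhileFalse: "reg s a = 0 \<Longrightarrow> exec B (While a c) s 1 s"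
| WhileTrue: "reg s a \<noteq> 0 \<Longrightarrow> exec B c s t1 s1 \<Longrightarrow> exec B (While a c) s1 t2 s2 \<Longrightarrow>
    exec B (While a c) s (Suc (t1 + t2)) s2"

inductive_cases exec_elims [elim!]:
  "exec B (Const a x) s t s'" "exec B (Arith f a b c) s t s'"
  "exec B (Load a b) s t s'" "exec B (Store a b) s t s'"
  "exec B (RMove a b) s t s'" "exec B (RLoad a b) s t s'" "exec B (RStore a b) s t s'"
  "exec B (RLess a b c) s t s'" "exec B (ROfWord a b) s t s'" "exec B (RFloor a b) s t s'"
  "exec B (Seq c1 c2) s t s'" "exec B (Cond a c1 c2) s t s'"

lemma exec_deterministic:
  "exec B c s t s' \<Longrightarrow> exec B c s u s'' \<Longrightarrow> u = t \<and> s'' = s'"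
proof (induction arbitrary: u s'' rule: exec.induct)
  case (Seq c1 s t1 s1 c2 t2 s2)
  from \<open>exec B (Seq c1 c2) s u s''\<close> obtain u1 r1 u2
    where "u = u1 + u2" "exec B c1 s u1 r1" "exec B c2 r1 u2 s''"
    by blast
  with Seq.IH show ?case by metis
next
  case (WhileFalse s a c)
  from \<open>exec B (While a c) s u s''\<close> show ?case using \<open>reg s a = 0\<close> by cases auto
next
  case (WhileTrue s a c t1 s1 t2 s2)
  from \<open>exec B (While a c) s u s''\<close> obtain u1 r1 u2
    where "u = Suc (u1 + u2)" "exec B c s u1 r1" "exec B (While a c) r1 u2 s''"
    using \<open>reg s a \<noteq> 0\<close> by cases auto
  with WhileTrue.IH show ?case by metis
next
  case (CondTrue s a c1 t s' c2)
  from \<open>exec B (Cond a c1 c2) s u s''\<close> \<open>reg s a \<noteq> 0\<close> CondTrue.IH show ?case by auto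
next
  case (CondFalse s a c2 t s' c1)
  from \<open>exec B (Cond a c1 c2) s u s''\<close> \<open>reg s a = 0\<close> CondFalse.IH show ?case by auto
qed auto

text \<open>
  Words have \<open>O(log n)\<close> bits: a program may use words below \<open>(n + 2) ^ k\<close> for a constant \<open>k\<close> of
  its choice (the \<open>2\<close> makes room for constants when \<open>n = 1\<close>).
\<close>

definition word_bound :: "nat \<Rightarrow> nat \<Rightarrow> nat" where
  "word_bound k n = (n + 2) ^ k"

text \<open>All cells are zero, except that register 0 holds the size parameter.\<close>

definition start :: "nat \<Rightarrow> state" where
  "start n = \<lparr>reg = (\<lambda>_. 0)(0 := n), mem = (\<lambda>_. 0), rreg = (\<lambda>_. 0), rmem = (\<lambda>_. 0)\<rparr>"


section \<open>Online Boolean matrix-vector multiplication\<close>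

text \<open>Only the entries with indices below \<open>n\<close> of a matrix or vector are relevant.\<close>

definition bool_mat_vec :: "nat \<Rightarrow> (nat \<Rightarrow> nat \<Rightarrow> bool) \<Rightarrow> (nat \<Rightarrow> bool) \<Rightarrow> nat \<Rightarrow> bool" where
  "bool_mat_vec n M v i \<longleftrightarrow> (\<exists>j<n. M i j \<and> v j)"

text \<open>The matrix is given in row-major order in memory cells \<open>0, \<dots>, n\<^sup>2 - 1\<close>.\<close>

definition omv_start :: "nat \<Rightarrow> (nat \<Rightarrow> nat \<Rightarrow> bool) \<Rightarrow> state" where
  "omv_start n M = (start n)\<lparr>mem := \<lambda>x. of_bool (x < n * n \<and> M (x div n) (x mod n))\<rparr>"

text \<open>Each vector is written to the \<open>n\<close> memory cells from \<open>n\<^sup>2\<close> on, leaving all other cells as the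
  program has left them; the product is then expected in the \<open>n\<close> cells from \<open>n\<^sup>2 + n\<close> on.\<close>

definition give_vector :: "nat \<Rightarrow> (nat \<Rightarrow> bool) \<Rightarrow> state \<Rightarrow> state" where
  "give_vector n v s =
    s\<lparr>mem := \<lambda>x. if n * n \<le> x \<and> x < n * n + n then of_bool (v (x - n * n)) else mem s x\<rparr>"

definition shows_vector :: "nat \<Rightarrow> (nat \<Rightarrow> bool) \<Rightarrow> state \<Rightarrow> bool" where
  "shows_vector n w s \<longleftrightarrow> (\<forall>i<n. mem s (n * n + n + i) = of_bool (w i))"

text \<open>\<open>T\<close> is the time remaining for all of the vectors together. As \<open>exec\<close> is deterministic, the
  output for a vector depends only on the matrix and the vectors up to this one.\<close>

fun omv_rounds ::
  "nat \<Rightarrow> nat \<Rightarrow> (nat \<Rightarrow> nat \<Rightarrow> bool) \<Rightarrow> com \<Rightarrow> nat \<Rightarrow> (nat \<Rightarrow> bool) list \<Rightarrow> state \<Rightarrow> bool" where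
  "omv_rounds B n M answer T [] s \<longleftrightarrow> True"
| "omv_rounds B n M answer T (v # vs) s \<longleftrightarrow>
    (\<exists>t s'. exec B answer (give_vector n v s) t s' \<and> t \<le> T \<and>
       shows_vector n (bool_mat_vec n M v) s' \<and> omv_rounds B n M answer (T - t) vs s')"

definition solves_OMv :: "com \<Rightarrow> com \<Rightarrow> (nat \<Rightarrow> nat) \<Rightarrow> bool" where
  "solves_OMv prep answer T \<longleftrightarrow>
    (\<exists>k. \<forall>n\<ge>1. \<forall>M vs. length vs = n \<longrightarrow>
       (\<exists>t s. exec (word_bound k n) prep (omv_start n M) t s \<and> t \<le> T n \<and>
          omv_rounds (word_bound k n) n M answer (T n - t) vs s))"

definition OMv_conjecture :: bool where
  "OMv_conjecture \<longleftrightarrow>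
    (\<forall>\<epsilon>::real. \<epsilon> > 0 \<longrightarrow>
       \<not> (\<exists>prep answer T. solves_OMv prep answer T \<and>
            (\<lambda>n. real (T n)) \<in> O(\<lambda>n. real n powr (3 - \<epsilon>))))"


section \<open>Incremental fully retroactive maximum degree\<close>

text \<open>The vertex set is \<open>{..<n}\<close>, an edge is a set of two vertices, and a set of timed insertions
  consists of pairs of an edge and its insertion time.\<close>

type_synonym edge = "nat set"

definition graph_at :: "(edge \<times> real) set \<Rightarrow> real \<Rightarrow> edge set" where
  "graph_at S t = {e. \<exists>t'. (e, t') \<in> S \<and> t' \<le> t}"

definition degree :: "edge set \<Rightarrow> nat \<Rightarrow> nat" where
  "degree E v = card {e \<in> E. v \<in> e}"

definition max_degree :: "nat \<Rightarrow> edge set \<Rightarrow> nat" where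
  "max_degree n E = Max (degree E ` {..<n})"

datatype update = Insert nat nat

datatype operation = Create update real | Query real

text \<open>The graph is simple: an edge is not inserted a second time.\<close>

definition can_insert :: "nat \<Rightarrow> (edge \<times> real) set \<Rightarrow> edge \<Rightarrow> real \<Rightarrow> bool" where
  "can_insert n S e t \<longleftrightarrow>
    e \<subseteq> {..<n} \<and> card e = 2 \<and> (\<forall>(e', t') \<in> S. e' \<noteq> e \<and> t' \<noteq> t)"

text \<open>
  \<open>serves B n create query U Q ops s S\<close>: from state \<open>s\<close>, which represents the insertions \<open>S\<close>, the
  operations \<open>ops\<close> are processed one after the other, each update taking at most \<open>U\<close> and
  each query at most \<open>Q\<close> steps and returning the right answer. Nothing is required from the first
  illegal insertion on. Vertices are passed in registers 0 and 1, times in real register 0, and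
  answers are returned in register 0.
\<close>

fun serves ::
  "nat \<Rightarrow> nat \<Rightarrow> com \<Rightarrow> com \<Rightarrow> nat \<Rightarrow> nat \<Rightarrow> operation list \<Rightarrow> state \<Rightarrow> (edge \<times> real) set \<Rightarrow> bool"
where
  "serves B n create query U Q [] s S \<longleftrightarrow> True"
| "serves B n create query U Q (Create (Insert u v) t # ops) s S \<longleftrightarrow>
    (can_insert n S {u, v} t \<longrightarrow>
      (\<exists>d s'. exec B create (set_rreg 0 t (set_reg 1 v (set_reg 0 u s))) d s' \<and> d \<le> U \<and>
         serves B n create query U Q ops s' (insert ({u, v}, t) S)))"
| "serves B n create query U Q (Query t # ops) s S \<longleftrightarrow>
    (\<exists>d s'. exec B query (set_rreg 0 t s) d s' \<and> d \<le> Q \<and>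
       reg s' 0 = max_degree n (graph_at S t) \<and> serves B n create query U Q ops s' S)"

text \<open>
  \<open>P\<close>, \<open>U\<close> and \<open>Q\<close> bound the worst-case time for setting up the structure for the empty graph, for
  an update and for a query, as functions of the number of vertices.
\<close>

definition retroactive_max_degree ::
  "com \<Rightarrow> com \<Rightarrow> com \<Rightarrow> (nat \<Rightarrow> nat) \<Rightarrow> (nat \<Rightarrow> nat) \<Rightarrow> (nat \<Rightarrow> nat) \<Rightarrow> bool" where
  "retroactive_max_degree init create query P U Q \<longleftrightarrow>
    (\<exists>k. \<forall>n\<ge>1. \<exists>d s. exec (word_bound k n) init (start n) d s \<and> d \<le> P n \<and>
       (\<forall>ops. serves (word_bound k n) n create query (U n) (Q n) ops s {}))"

end

theory Submission
  imports Defs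
begin

text \<open>
  Encode the matrix and the vectors in the degrees of \<open>n\<close> main vertices \<open>j < n\<close>, each of which may
  be joined to \<open>3 n\<close> helper vertices \<open>n + c\<close>, one per column \<open>c < 3 n\<close>. A helper never has degree
  above \<open>n\<close>, while joining all main vertices to the first \<open>n\<close> helpers lifts these to degree \<open>n\<close>, so
  that only main vertices matter. Row \<open>i\<close> of the matrix is a column inserted during a late interval of
  time: first the edges of the \<open>j\<close> with \<open>M i j\<close>, then those of all other \<open>j\<close>. Just between the two
  the degree of \<open>j\<close> is \<open>i\<close> plus the entry \<open>M i j\<close>, up to a constant. The \<open>r\<close>-th vector \<open>v\<close> is a column
  inserted retroactively at an early time, only at the \<open>j\<close> with \<open>v j\<close>. A query in the middle of row \<open>i\<close> then
  exceeds \<open>n + r + i + 1\<close> iff \<open>M i j\<close> and \<open>v j\<close> for some \<open>j\<close>. Afterwards the column is completed at the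
  other \<open>j\<close>, which makes the early degrees equal again: no deletions are needed. All this costs
  \<open>O(n\<^sup>2)\<close> operations on a graph with \<open>4 n\<close> vertices.
\<close>

section \<open>Time-counting weakest preconditions\<close>

text \<open>The time \<open>t\<close> already spent is an accumulator, so that running-time bounds
  become part of the postcondition. The existential also asserts termination and the absence of word
  overflow.\<close>

definition wp :: "nat \<Rightarrow> com \<Rightarrow> state \<Rightarrow> nat \<Rightarrow> (state \<Rightarrow> nat \<Rightarrow> bool) \<Rightarrow> bool" where
  "wp B c s t Q \<longleftrightarrow> (\<exists>d s'. exec B c s d s' \<and> Q s' (t + d))"

lemma wp_step:
  assumes "\<And>d s'. exec B c s d s' \<longleftrightarrow> P \<and> d = Suc 0 \<and> s' = z"
  shows "wp B c s t Q \<longleftrightarrow> P \<and> Q z (Suc t)"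
  using assms by (auto simp: wp_def)

lemmas exec_atom = exec.Const exec.Arith exec.Load exec.Store exec.RMove exec.RLoad exec.RStore
  exec.RLess exec.ROfWord exec.RFloor

lemma wp_atom [simp]:
  "wp B (Const a x) s t Q \<longleftrightarrow> x < B \<and> Q (set_reg a x s) (Suc t)"
  "wp B (Arith f a b c) s t Q \<longleftrightarrow> arith_sem f (reg s b) (reg s c) < B \<and>
     Q (set_reg a (arith_sem f (reg s b) (reg s c)) s) (Suc t)"
  "wp B (Load a b) s t Q \<longleftrightarrow> Q (set_reg a (mem s (reg s b)) s) (Suc t)"
  "wp B (Store a b) s t Q \<longleftrightarrow> Q (s\<lparr>mem := (mem s)(reg s a := reg s b)\<rparr>) (Suc t)"
  "wp B (RMove a b) s t Q \<longleftrightarrow> Q (set_rreg a (rreg s b) s) (Suc t)"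
  "wp B (RLoad a b) s t Q \<longleftrightarrow> Q (set_rreg a (rmem s (reg s b)) s) (Suc t)"
  "wp B (RStore a b) s t Q \<longleftrightarrow> Q (s\<lparr>rmem := (rmem s)(reg s a := rreg s b)\<rparr>) (Suc t)"
  "wp B (RLess a b c) s t Q \<longleftrightarrow> Q (set_reg a (of_bool (rreg s b < rreg s c)) s) (Suc t)"
  "wp B (ROfWord a b) s t Q \<longleftrightarrow> Q (set_rreg a (real (reg s b)) s) (Suc t)"
  by (rule wp_step[where P = True, unfolded simp_thms] wp_step, blast intro: exec_atom[unfolded One_nat_def])+

lemma wp_RFloor [simp]:
  "wp B (RFloor a b) s t Q \<longleftrightarrow> 0 \<le> rreg s b \<and> nat \<lfloor>rreg s b\<rfloor> < B \<and>
     Q (set_reg a (nat \<lfloor>rreg s b\<rfloor>) s) (Suc t)"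
proof -
  have "exec B (RFloor a b) s d s' \<longleftrightarrow> (0 \<le> rreg s b \<and> nat \<lfloor>rreg s b\<rfloor> < B) \<and> d = Suc 0 \<and>
      s' = set_reg a (nat \<lfloor>rreg s b\<rfloor>) s" (is "_ \<longleftrightarrow> ?r") for d s'
  proof
    show "exec B (RFloor a b) s d s' \<Longrightarrow> ?r" by (ind_cases "exec B (RFloor a b) s d s'") simp_all
    show "?r \<Longrightarrow> exec B (RFloor a b) s d s'"
      using exec.RFloor[of s b B a] by (elim conjE) (simp only: One_nat_def)
  qed
  from wp_step[OF this] show ?thesis by simp
qed

lemma wp_compound [simp]:
  "wp B (Seq c1 c2) s t Q \<longleftrightarrow> wp B c1 s t (\<lambda>s' t'. wp B c2 s' t' Q)"
  "wp B (Cond a c1 c2) s t Q \<longleftrightarrow> wp B (if reg s a \<noteq> 0 then c1 else c2) s (Suc t) Q"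
proof -
  show "wp B (Seq c1 c2) s t Q \<longleftrightarrow> wp B c1 s t (\<lambda>s' t'. wp B c2 s' t' Q)"
  proof
    show "wp B (Seq c1 c2) s t Q \<Longrightarrow> wp B c1 s t (\<lambda>s' t'. wp B c2 s' t' Q)"
      unfolding wp_def by (auto simp: add.assoc)
    show "wp B c1 s t (\<lambda>s' t'. wp B c2 s' t' Q) \<Longrightarrow> wp B (Seq c1 c2) s t Q"
      unfolding wp_def by (metis add.assoc exec.Seq)
  qed
  show "wp B (Cond a c1 c2) s t Q \<longleftrightarrow> wp B (if reg s a \<noteq> 0 then c1 else c2) s (Suc t) Q"
  proof
    show "wp B (Cond a c1 c2) s t Q \<Longrightarrow> wp B (if reg s a \<noteq> 0 then c1 else c2) s (Suc t) Q"
      unfolding wp_def by (auto, (metis add_Suc_right)+)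
    assume *: "wp B (if reg s a \<noteq> 0 then c1 else c2) s (Suc t) Q"
    then obtain d s' where d: "exec B (if reg s a \<noteq> 0 then c1 else c2) s d s'" "Q s' (t + Suc d)"
      unfolding wp_def by auto
    then have "exec B (Cond a c1 c2) s (Suc d) s'"
      by (cases "reg s a = 0") (simp_all add: exec.CondFalse exec.CondTrue)
    then show "wp B (Cond a c1 c2) s t Q"
      using d(2) unfolding wp_def by (intro exI[of _ "Suc d"] exI[of _ s'] conjI)
  qed
qed

lemma wp_mono:
  assumes "wp B c s t Q" and "\<And>s' t'. Q s' t' \<Longrightarrow> R s' t'"
  shows "wp B c s t R"
  using assms unfolding wp_def by blast

inductive_cases exec_WhileE: "exec B (While a c) s t s'"

text \<open>An unfolding by one iteration, kept out of the simplifier because it would loop.\<close>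

lemma wp_While:
  "wp B (While a c) s t Q \<longleftrightarrow>
     (if reg s a = 0 then Q s (Suc t) else wp B c s (Suc t) (\<lambda>s' t'. wp B (While a c) s' t' Q))"
proof (cases "reg s a = 0")
  case True
  then have "exec B (While a c) s d s' \<longleftrightarrow> d = 1 \<and> s' = s" for d s'
    by (metis WhileFalse exec_deterministic)
  then show ?thesis by (simp add: wp_def True)
next
  case False
  have "exec B (While a c) s d s' \<longleftrightarrow>
      (\<exists>d1 s1 d2. d = Suc (d1 + d2) \<and> exec B c s d1 s1 \<and> exec B (While a c) s1 d2 s')" for d s'
  proof
    assume "exec B (While a c) s d s'"
    then show "\<exists>d1 s1 d2. d = Suc (d1 + d2) \<and> exec B c s d1 s1 \<and> exec B (While a c) s1 d2 s'"
      by (rule exec_WhileE) (use False in auto)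
  next
    assume "\<exists>d1 s1 d2. d = Suc (d1 + d2) \<and> exec B c s d1 s1 \<and> exec B (While a c) s1 d2 s'"
    then show "exec B (While a c) s d s'"
      using False exec.WhileTrue by blast
  qed
  note step = this
  show ?thesis
  proof
    assume "wp B (While a c) s t Q"
    then obtain d1 s1 d2 s' where d: "exec B c s d1 s1" "exec B (While a c) s1 d2 s'"
        "Q s' (t + Suc (d1 + d2))"
      unfolding wp_def step by blast
    then have "Q s' (Suc t + d1 + d2)" by (simp add: add.assoc)
    with d(1,2) show "if reg s a = 0 then Q s (Suc t)
        else wp B c s (Suc t) (\<lambda>s' t'. wp B (While a c) s' t' Q)"
      unfolding wp_def if_not_P[OF False] by (intro exI conjI)
  next
    assume "if reg s a = 0 then Q s (Suc t)
        else wp B c s (Suc t) (\<lambda>s' t'. wp B (While a c) s' t' Q)"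
    then obtain d1 s1 d2 s' where d: "exec B c s d1 s1" "exec B (While a c) s1 d2 s'"
        "Q s' (Suc t + d1 + d2)"
      using False unfolding wp_def by auto
    then have "exec B (While a c) s (Suc (d1 + d2)) s'" "Q s' (t + Suc (d1 + d2))"
      using False exec.WhileTrue by (simp_all add: add.assoc)
    then show "wp B (While a c) s t Q" unfolding wp_def by (intro exI conjI)
  qed
qed

text \<open>Register 3 is expected to hold the constant 1.\<close>

definition for_to :: "nat \<Rightarrow> com \<Rightarrow> com" where
  "for_to l c = Seq (Const 4 0) (Seq (Arith Less 5 4 l)
     (While 5 (Seq c (Seq (Arith Add 4 4 3) (Arith Less 5 4 l)))))"

text \<open>Invariant rule with \<open>I p\<close> holding before iteration \<open>p\<close>.
  Besides the body, a round pays for the loop test, the increment and the comparison, hence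
  \<open>C + 3\<close>; the final 3 covers the two initial instructions and the failing test. As
  \<open>I\<close> ignores registers 4 and 5, the loop may overwrite them.\<close>

lemma wp_for_to:
  fixes I :: "nat \<Rightarrow> state \<Rightarrow> bool"
  assumes m: "m < B" "1 < B"
    and regs: "\<And>p s. I p s \<Longrightarrow> reg s 3 = 1 \<and> reg s l = m"
    and stable: "\<And>p s x y. I p s \<Longrightarrow> I p (s\<lparr>reg := (reg s)(4 := x, 5 := y)\<rparr>)"
    and body: "\<And>p s t. p < m \<Longrightarrow> I p s \<Longrightarrow> reg s 4 = p \<Longrightarrow>
      wp B c s t (\<lambda>s' t'. I (Suc p) s' \<and> reg s' 4 = p \<and> t' \<le> t + C)"
    and init: "I 0 s"
    and post: "\<And>s' t'. I m s' \<Longrightarrow> t' \<le> t + m * (C + 3) + 3 \<Longrightarrow> Q s' t'"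
  shows "wp B (for_to l c) s t Q"
proof -
  let ?W = "While 5 (Seq c (Seq (Arith Add 4 4 3) (Arith Less 5 4 l)))"
  have l: "l \<noteq> 4" "l \<noteq> 5" if "I p s" for p s
  proof -
    \<comment> \<open>Writing \<open>Suc m\<close> to both loop registers preserves the invariant,
      which still forces register \<open>l\<close> to hold \<open>m\<close>; so \<open>l\<close> is
      neither of them.\<close>
    have "I p (s\<lparr>reg := (reg s)(4 := Suc m, 5 := Suc m)\<rparr>)" using stable that by blast
    from regs[OF this] show "l \<noteq> 4" "l \<noteq> 5" by auto
  qed
  \<comment> \<open>Induction on the number \<open>k\<close> of iterations left; the extra step is
    the failing test at the end.\<close>
  have loop: "wp B ?W s t (\<lambda>s' t'. I m s' \<and> t' \<le> t + k * (C + 3) + 1)"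
    if "I p s" "reg s 4 = p" "reg s 5 = of_bool (p < m)" "p + k = m" for p k s t
    using that
  proof (induction k arbitrary: p s t)
    case 0
    then show ?case by (subst wp_While) auto
  next
    case (Suc k)
    let ?R = "\<lambda>s' t'. I m s' \<and> t' \<le> t + Suc k * (C + 3) + 1"
    have "wp B c s (Suc t)
      (\<lambda>s' t'. wp B (Seq (Arith Add 4 4 3) (Arith Less 5 4 l)) s' t' (\<lambda>s' t'. wp B ?W s' t' ?R))"
    proof (rule wp_mono[OF body])
      show "p < m" "I p s" "reg s 4 = p" using Suc.prems by auto
      fix s' t' assume *: "I (Suc p) s' \<and> reg s' 4 = p \<and> t' \<le> Suc t + C"
      let ?s = "s'\<lparr>reg := (reg s')(4 := Suc p, 5 := of_bool (Suc p < m))\<rparr>"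
      have "wp B ?W ?s (Suc (Suc t')) (\<lambda>s' t''. I m s' \<and> t'' \<le> Suc (Suc t') + k * (C + 3) + 1)"
        by (rule Suc.IH[of "Suc p"]) (use Suc.prems * in \<open>auto intro: stable\<close>)
      then have "wp B ?W ?s (Suc (Suc t')) ?R"
        by (rule wp_mono) (use * in auto)
      then show "wp B (Seq (Arith Add 4 4 3) (Arith Less 5 4 l)) s' t' (\<lambda>s' t'. wp B ?W s' t' ?R)"
        using regs[of "Suc p" s'] l[of "Suc p" s'] * Suc.prems m
        by (cases "Suc p < m") simp_all
    qed
    then show ?case using Suc.prems by (subst wp_While) simp
  qed
  have "wp B ?W (s\<lparr>reg := (reg s)(4 := 0, 5 := of_bool (0 < m))\<rparr>) (Suc (Suc t)) Q"
    by (rule wp_mono[OF loop[of 0 _ m]]) (use post init in \<open>auto intro: stable\<close>)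
  then show ?thesis
    using regs[OF init] l[OF init] m by (simp add: for_to_def)
qed


section \<open>Relocated programs\<close>

text \<open>
  The program of the data structure runs inside a larger program: its registers are shifted by 16,
  its memory by the content of register 1, and register 2 is scratch space for addresses. Real
  registers and real memory are shared.
\<close>

fun relocate :: "com \<Rightarrow> com" where
  "relocate (Const a x) = Const (16 + a) x"
| "relocate (Arith f a b c) = Arith f (16 + a) (16 + b) (16 + c)"
| "relocate (Load a b) = Seq (Arith Add 2 (16 + b) 1) (Load (16 + a) 2)"
| "relocate (Store a b) = Seq (Arith Add 2 (16 + a) 1) (Store 2 (16 + b))"
| "relocate (RMove a b) = RMove a b"
| "relocate (RLoad a b) = RLoad a (16 + b)"
| "relocate (RStore a b) = RStore (16 + a) b"
| "relocate (RLess a b c) = RLess (16 + a) b c"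
| "relocate (ROfWord a b) = ROfWord a (16 + b)"
| "relocate (RFloor a b) = RFloor (16 + a) b"
| "relocate (Seq c1 c2) = Seq (relocate c1) (relocate c2)"
| "relocate (Cond a c1 c2) = Cond (16 + a) (relocate c1) (relocate c2)"
| "relocate (While a c) = While (16 + a) (relocate c)"

definition sim :: "nat \<Rightarrow> state \<Rightarrow> state \<Rightarrow> bool" where
  "sim d s z \<longleftrightarrow> (\<forall>a. reg z (16 + a) = reg s a) \<and> (\<forall>x. mem z (d + x) = mem s x) \<and>
     rreg z = rreg s \<and> rmem z = rmem s \<and> reg z 1 = d"

text \<open>This keeps relocated addresses representable: an address below \<open>B\<close>, shifted
  by the offset \<open>d\<close>, stays below \<open>B + d\<close>.\<close>

definition words :: "nat \<Rightarrow> state \<Rightarrow> bool" where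
  "words B s \<longleftrightarrow> (\<forall>a. reg s a < B) \<and> (\<forall>x. mem s x < B)"

text \<open>The surrounding program owns registers 0 to 15 and the memory below \<open>d\<close>;
  register 2 is exempt as scratch space.\<close>

definition frame :: "nat \<Rightarrow> state \<Rightarrow> state \<Rightarrow> bool" where
  "frame d z z' \<longleftrightarrow> (\<forall>a<16. a \<noteq> 2 \<longrightarrow> reg z' a = reg z a) \<and> (\<forall>x<d. mem z' x = mem z x)"

lemma exec_words: "exec B c s t s' \<Longrightarrow> 2 \<le> B \<Longrightarrow> words B s \<Longrightarrow> words B s'"
  by (induction rule: exec.induct) (auto simp: words_def)

lemma frame_trans: "frame d z z' \<Longrightarrow> frame d z' z'' \<Longrightarrow> frame d z z''"
  by (simp add: frame_def)

text \<open>A load or store becomes two instructions and every other instruction stays one, hence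
  the factor 2. Induction on the run, with \<open>words\<close> carried along so that each address
  computation fits below \<open>B'\<close>.\<close>

lemma wp_relocate:
  assumes "exec B c s t s'" "sim d s z" "words B s" "2 \<le> B" "B + d \<le> B'"
  shows "wp B' (relocate c) z u (\<lambda>z' u'. sim d s' z' \<and> frame d z z' \<and> u' \<le> u + 2 * t)"
  using assms
proof (induction arbitrary: z u rule: exec.induct)
  case (Load a b s)
  then have "reg s b < B" by (auto simp: words_def)
  with Load show ?case by (auto simp: sim_def frame_def add.commute)
next
  case (Store a b s)
  then have "reg s a < B" by (auto simp: words_def)
  with Store show ?case by (auto simp: sim_def frame_def add.commute)
next
  case (Seq c1 s t1 s1 c2 t2 s2)
  have w: "words B s1" using exec_words Seq.hyps(1) Seq.prems by blast
  have "wp B' (relocate c1) z u (\<lambda>z' u'. wp B' (relocate c2) z' u'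
      (\<lambda>z' u'. sim d s2 z' \<and> frame d z z' \<and> u' \<le> u + 2 * (t1 + t2)))"
    by (rule wp_mono[OF Seq.IH(1)[OF Seq.prems]], rule wp_mono[OF Seq.IH(2)[OF _ w Seq.prems(3,4)]])
      (auto intro: frame_trans)
  then show ?case by simp
next
  case (CondTrue s a c1 t s' c2)
  then have "reg z (16 + a) \<noteq> 0" by (simp add: sim_def)
  then show ?case
    by (auto intro: wp_mono[OF CondTrue.IH] CondTrue.prems)
next
  case (CondFalse s a c2 t s' c1)
  then have "reg z (16 + a) = 0" by (simp add: sim_def)
  then show ?case
    by (auto intro: wp_mono[OF CondFalse.IH] CondFalse.prems)
next
  case (WhileFalse s a c)
  then have "reg z (16 + a) = 0" by (simp add: sim_def)
  then show ?case using WhileFalse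
    by (subst relocate.simps, subst wp_While) (auto simp: frame_def)
next
  case (WhileTrue s a c t1 s1 t2 s2)
  then have "reg z (16 + a) \<noteq> 0" by (simp add: sim_def)
  moreover have w: "words B s1" using exec_words WhileTrue.hyps(2) WhileTrue.prems by blast
  have "wp B' (relocate c) z (Suc u) (\<lambda>z' u'. wp B' (While (16 + a) (relocate c)) z' u'
      (\<lambda>z' u'. sim d s2 z' \<and> frame d z z' \<and> u' \<le> u + 2 * Suc (t1 + t2)))"
    by (rule wp_mono[OF WhileTrue.IH(1)[OF WhileTrue.prems]],
        rule wp_mono[OF WhileTrue.IH(2)[unfolded relocate.simps, OF _ w WhileTrue.prems(3,4)]])
      (auto intro: frame_trans)
  ultimately show ?case by (subst relocate.simps, subst wp_While) simp
next
  case (Const x a s)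
  then show ?case by (simp add: sim_def frame_def)
next
  case (Arith f s b c a)
  then show ?case by (simp add: sim_def frame_def)
next
  case (RMove a b s)
  then show ?case by (simp add: sim_def frame_def)
next
  case (RLoad a b s)
  then show ?case by (simp add: sim_def frame_def)
next
  case (RStore a b s)
  then show ?case by (simp add: sim_def frame_def)
next
  case (RLess a b c s)
  then show ?case by (simp add: sim_def frame_def)
next
  case (ROfWord a b s)
  then show ?case by (simp add: sim_def frame_def)
next
  case (RFloor s b a)
  then show ?case by (simp add: sim_def frame_def)
qed


section \<open>Degrees in the reduction\<close>

text \<open>
  The edges of a column occupy one slot of \<open>n\<close> consecutive times, except that column \<open>2 n + i\<close>, which
  encodes row \<open>i\<close>, is spread over the slots \<open>2 n + 2 i\<close> (ones) and \<open>2 n + 2 i + 1\<close> (zeros).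
\<close>

definition slot :: "nat \<Rightarrow> (nat \<Rightarrow> nat \<Rightarrow> bool) \<Rightarrow> nat \<Rightarrow> nat \<Rightarrow> nat" where
  "slot n M j c = (if c < 2 * n then c else 2 * c + 1 - 2 * n - of_bool (M (c - 2 * n) j))"

definition ins_time :: "nat \<Rightarrow> (nat \<Rightarrow> nat \<Rightarrow> bool) \<Rightarrow> nat \<Rightarrow> nat \<Rightarrow> nat" where
  "ins_time n M j c = slot n M j c * n + j"

definition timed_edge :: "nat \<Rightarrow> (nat \<Rightarrow> nat \<Rightarrow> bool) \<Rightarrow> nat \<times> nat \<Rightarrow> edge \<times> real" where
  "timed_edge n M = (\<lambda>(j, c). ({j, n + c}, real (ins_time n M j c)))"

text \<open>Columns below \<open>2 * n\<close> are their own slots, and column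
  \<open>2 * n + i\<close> uses one of the two slots \<open>2 * n + 2 * i\<close> and
  \<open>2 * n + 2 * i + 1\<close>, so different columns never share a slot.\<close>

lemma slot_inj: "slot n M j c = slot n M j c' \<Longrightarrow> c = c'"
  by (auto simp: slot_def of_bool_def split: if_splits)

text \<open>Division by \<open>n\<close> with remainder recovers the slot and the main vertex from
  the time.\<close>

lemma ins_time_inj:
  assumes "ins_time n M j c = ins_time n M j' c'" "j < n" "j' < n"
  shows "j = j' \<and> c = c'"
proof -
  have "(slot n M j c * n + j) mod n = (slot n M j' c' * n + j') mod n"
    using assms by (simp add: ins_time_def)
  then have "j = j'" using assms by simp
  then have "slot n M j c = slot n M j c'" using assms by (simp add: ins_time_def)
  with \<open>j = j'\<close> show ?thesis using slot_inj by blast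
qed

text \<open>Time \<open>k * n - 1\<close> is the last one of slot \<open>k - 1\<close>, so a query
  there sees exactly the slots below \<open>k\<close>.\<close>

lemma ins_time_less:
  assumes "j < n" "0 < k"
  shows "ins_time n M j c \<le> k * n - 1 \<longleftrightarrow> slot n M j c < k"
proof (cases "slot n M j c < k")
  case True
  then have "Suc (slot n M j c) * n \<le> k * n" by (intro mult_le_mono1) simp
  then show ?thesis using True assms by (simp add: ins_time_def)
next
  case False
  then have "k * n \<le> slot n M j c * n" by (intro mult_le_mono1) simp
  moreover have "0 < k * n" using assms by simp
  ultimately show ?thesis using False unfolding ins_time_def by linarith
qed

lemma edge_eq_iff: "j < n \<Longrightarrow> j' < n \<Longrightarrow> {j, n + c} = {j', n + c'} \<longleftrightarrow> j = j' \<and> c = c'" for n :: nat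
  by (auto simp: doubleton_eq_iff)

text \<open>Both the edge and the time determine the pair \<open>(j, c)\<close>, so a fresh pair
  gives a fresh edge and a fresh time.\<close>

lemma can_insert_timed_edge:
  assumes "A \<subseteq> {..<n} \<times> {..<3 * n}" "j < n" "c < 3 * n" "(j, c) \<notin> A"
  shows "can_insert (4 * n) (timed_edge n M ` A) {j, n + c} (real (ins_time n M j c))"
proof -
  have "{j', n + c'} \<noteq> {j, n + c} \<and> ins_time n M j' c' \<noteq> ins_time n M j c" if "(j', c') \<in> A" for j' c'
  proof -
    have "j' < n" using assms that by auto
    then show ?thesis
      using assms that edge_eq_iff[of j' n j c' c] ins_time_inj[of n M j' c' j c] by metis
  qed
  then show ?thesis
    using assms by (auto simp: can_insert_def timed_edge_def)
qed

lemma graph_at_timed_edge: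
  assumes "A \<subseteq> {..<n} \<times> UNIV" "0 < k"
  shows "graph_at (timed_edge n M ` A) (real (k * n - 1)) =
    (\<lambda>(j, c). {j, n + c}) ` {(j, c) \<in> A. slot n M j c < k}"
proof -
  have "ins_time n M j c \<le> k * n - 1 \<longleftrightarrow> slot n M j c < k" if "(j, c) \<in> A" for j c
    using ins_time_less that assms by auto
  then show ?thesis
    unfolding graph_at_def timed_edge_def of_nat_le_iff[where 'a = real, symmetric]
    by (force simp: image_iff)
qed

text \<open>Edges at a main vertex correspond bijectively to its columns, whereas a helper has at
  most one edge to each of the \<open>n\<close> main vertices.\<close>

lemma
  assumes A: "A \<subseteq> {..<n} \<times> UNIV"
  defines "E \<equiv> (\<lambda>(j, c). {j, n + c}) ` A"
  shows degree_main: "j < n \<Longrightarrow> degree E j = card {c. (j, c) \<in> A}"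
    and degree_helper: "degree E (n + c) \<le> n"
proof -
  show "degree E j = card {c. (j, c) \<in> A}" if "j < n"
  proof -
    have "{e \<in> E. j \<in> e} = (\<lambda>c. {j, n + c}) ` {c. (j, c) \<in> A}"
      using A that by (auto simp: E_def)
    moreover have "inj_on (\<lambda>c. {j, n + c}) {c. (j, c) \<in> A}"
      using edge_eq_iff that by (intro inj_onI) blast
    ultimately show ?thesis by (simp add: degree_def card_image)
  qed
  have "{e \<in> E. n + c \<in> e} \<subseteq> (\<lambda>j. {j, n + c}) ` {..<n}"
    using A by (auto simp: E_def)
  then have "degree E (n + c) \<le> card ((\<lambda>j. {j, n + c}) ` {..<n})"
    unfolding degree_def by (intro card_mono) auto
  also have "\<dots> \<le> n" using card_image_le[of "{..<n}" "\<lambda>j. {j, n + c}"] by simp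
  finally show "degree E (n + c) \<le> n" .
qed

text \<open>The insertions present when \<open>k - n\<close> vectors have been processed.\<close>

definition filled :: "nat \<Rightarrow> nat \<Rightarrow> (nat \<times> nat) set" where
  "filled n k = {..<n} \<times> ({..<k} \<union> {2 * n..<3 * n})"

text \<open>The query falls between the ones and the zeros of row \<open>i\<close>. By then
  \<open>j\<close> has degree \<open>n + r + i\<close> plus the bits \<open>v j\<close> and
  \<open>M i j\<close>, which exceeds the threshold iff both bits are 1.\<close>

lemma query_answer:
  fixes n r i :: nat and v :: "nat \<Rightarrow> bool"
  defines "A \<equiv> filled n (n + r) \<union> {(j, n + r) |j. j < n \<and> v j}"
  assumes "r < n" "i < n"
  shows "n + r + i + 1 < max_degree (4 * n)
      (graph_at (timed_edge n M ` A) (real ((2 * n + 2 * i + 1) * n - 1)))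
    \<longleftrightarrow> bool_mat_vec n M v i"
proof -
  define A' where "A' = {(j, c) \<in> A. slot n M j c < 2 * n + 2 * i + 1}"
  define E :: "nat set set" where "E = (\<lambda>(j, c). {j, n + c}) ` A'"
  have sub: "A \<subseteq> {..<n} \<times> UNIV" "A' \<subseteq> {..<n} \<times> UNIV"
    by (auto simp: A_def A'_def filled_def)
  have deg: "degree E j = n + r + of_bool (v j) + i + of_bool (M i j)" if "j < n" for j
  proof -
    have "{c. (j, c) \<in> A'} = ({..<n + r} \<union> (if v j then {n + r} else {})) \<union>
        ({2 * n..<2 * n + i} \<union> (if M i j then {2 * n + i} else {}))"
    proof (intro set_eqI)
      fix c
      have "(j, c) \<in> A \<longleftrightarrow> c < n + r \<or> 2 * n \<le> c \<and> c < 3 * n \<or> c = n + r \<and> v j"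
        using that by (auto simp: A_def filled_def)
      \<comment> \<open>Row columns \<open>2 * n + k\<close> with \<open>k < i\<close> lie before
        the query in both of their slots, those with \<open>k > i\<close> after it; for
        \<open>k = i\<close> only the slot of the ones does.\<close>
      moreover have "slot n M j c < 2 * n + 2 * i + 1 \<longleftrightarrow>
          c < 2 * n \<or> 2 * n \<le> c \<and> c < 2 * n + i \<or> c = 2 * n + i \<and> M i j"
      proof (cases "2 * n \<le> c")
        case True
        then obtain k where "c = 2 * n + k" using le_Suc_ex by blast
        then show ?thesis
          by (cases k i rule: linorder_cases) (auto simp: slot_def of_bool_def)
      qed (simp add: slot_def)
      moreover have "c < n + r \<Longrightarrow> c < 2 * n" "c = n + r \<Longrightarrow> c < 2 * n"
        "c < 2 * n + i \<Longrightarrow> c < 3 * n" "c = 2 * n + i \<Longrightarrow> 2 * n \<le> c \<and> c < 3 * n"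
        using assms(2,3) by auto
      ultimately have "(j, c) \<in> A' \<longleftrightarrow> c < n + r \<or> c = n + r \<and> v j \<or>
          2 * n \<le> c \<and> c < 2 * n + i \<or> c = 2 * n + i \<and> M i j"
        unfolding A'_def using not_le by blast
      then show "c \<in> {c. (j, c) \<in> A'} \<longleftrightarrow> c \<in> ({..<n + r} \<union> (if v j then {n + r} else {})) \<union>
          ({2 * n..<2 * n + i} \<union> (if M i j then {2 * n + i} else {}))"
        by simp
    qed
    moreover have "card (({..<n + r} \<union> (if v j then {n + r} else {})) \<union>
          ({2 * n..<2 * n + i} \<union> (if M i j then {2 * n + i} else {}))) =
        card ({..<n + r} \<union> (if v j then {n + r} else {})) +
        card ({2 * n..<2 * n + i} \<union> (if M i j then {2 * n + i} else {}))"
      using assms by (intro card_Un_disjoint) auto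
    ultimately show ?thesis
      using degree_main[OF sub(2) that] by (simp add: E_def)
  qed
  have "n + r + i + 1 < max_degree (4 * n) E \<longleftrightarrow> (\<exists>w<4 * n. n + r + i + 1 < degree E w)"
    unfolding max_degree_def by (subst Max_gr_iff) (use assms(2) in \<open>auto simp: lessThan_empty_iff\<close>)
  also have "\<dots> \<longleftrightarrow> (\<exists>j<n. n + r + i + 1 < degree E j)"
  proof -
    \<comment> \<open>The threshold is at least \<open>n + 1\<close>, out of reach for a
      helper.\<close>
    have "w < n" if "n + r + i + 1 < degree E w" for w
    proof (rule ccontr)
      assume "\<not> w < n"
      then have "w = n + (w - n)" by simp
      then have "degree E w \<le> n" using degree_helper[OF sub(2)] by (metis E_def)
      then show False using that by simp
    qed
    moreover have "n \<le> 4 * n" by simp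
    ultimately show ?thesis by (meson less_le_trans)
  qed
  also have "\<dots> \<longleftrightarrow> bool_mat_vec n M v i"
    unfolding bool_mat_vec_def using deg by (auto simp: of_bool_def split: if_splits)
  finally show ?thesis
    using graph_at_timed_edge[OF sub(1), where k = "2 * n + 2 * i + 1" and M = M]
    by (simp only: E_def A'_def)
qed


section \<open>The reduction as a program\<close>

text \<open>
  Registers of the surrounding program: 0 holds \<open>n\<close>, 1 the address \<open>n\<^sup>2 + 2 n\<close> from which on the memory
  belongs to the data structure, 3 the constant 1, 4 and 5 the loop counter and condition, 10 holds
  \<open>n\<^sup>2\<close>, and 12 holds \<open>n + r\<close> in round \<open>r\<close>. As there is no move instruction, \<open>Or\<close> of a register with
  itself is used.
\<close>

definition insert_at :: "com \<Rightarrow> nat \<Rightarrow> nat \<Rightarrow> nat \<Rightarrow> com" where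
  "insert_at create a b c =
     Seq (Arith Or 16 a a) (Seq (Arith Or 17 b b) (Seq (ROfWord 0 c) (relocate create)))"

definition query_at :: "com \<Rightarrow> nat \<Rightarrow> com" where
  "query_at query c = Seq (ROfWord 0 c) (relocate query)"

text \<open>Counter \<open>p = i * n + j\<close> addresses the matrix entry \<open>M i j\<close>. It
  is also the time of the lifting edge from \<open>j\<close> to column \<open>i\<close>. Register 11
  then computes the time \<open>(2 * (n + i) + 1 - M i j) * n + j\<close> of the edge to the row
  column \<open>2 * n + i\<close>, whose helper is \<open>3 * n + i\<close>.\<close>

definition prep_body :: "com \<Rightarrow> com" where
  "prep_body create =
     Seq (Arith Mod 6 4 0) (Seq (Arith Div 7 4 0) (Seq (Arith Add 7 7 0)
     (Seq (insert_at create 6 7 4)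
     (Seq (Load 8 4) (Seq (Arith Add 11 7 7) (Seq (Arith Add 11 11 3) (Seq (Arith Sub 11 11 8)
     (Seq (Arith Mul 11 11 0) (Seq (Arith Add 11 11 6)
     (Seq (Arith Add 7 7 0) (Seq (Arith Add 7 7 0)
     (insert_at create 6 7 11))))))))))))"

text \<open>Register 16 is the relocated register 0 and receives the size parameter
  \<open>4 * n\<close>; register 12 is a temporary for this before it becomes the column counter,
  starting at \<open>n\<close>.\<close>

definition omv_prep :: "com \<Rightarrow> com \<Rightarrow> com" where
  "omv_prep init create =
     Seq (Const 3 1) (Seq (Arith Mul 10 0 0) (Seq (Arith Add 1 10 0) (Seq (Arith Add 1 1 0)
     (Seq (Arith Add 12 0 0) (Seq (Arith Add 16 12 12) (Seq (Arith Or 12 0 0)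
     (Seq (relocate init) (for_to 10 (prep_body create)))))))))"

text \<open>The flag \<open>pos\<close> selects whether the ones or the zeros of the vector are
  inserted. The current column is below \<open>2 * n\<close> and hence its own slot, which gives the
  time in register 11.\<close>

definition fill_body :: "com \<Rightarrow> bool \<Rightarrow> com" where
  "fill_body create pos =
     (let ins = Seq (Arith Add 7 12 0) (Seq (Arith Mul 11 12 0) (Seq (Arith Add 11 11 4)
            (insert_at create 4 7 11)));
          skip = Const 8 0
      in Seq (Arith Add 8 10 4) (Seq (Load 8 8) (if pos then Cond 8 ins skip else Cond 8 skip ins)))"

text \<open>Register 11 first holds the query time \<open>(2 * (n + i) + 1) * n - 1\<close>, then
  the threshold \<open>n + r + i + 1\<close>, and finally the comparison with the answer in register
  16, the relocated register 0.\<close>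

definition query_body :: "com \<Rightarrow> com" where
  "query_body query =
     Seq (Arith Add 11 0 4) (Seq (Arith Add 11 11 11) (Seq (Arith Add 11 11 3)
     (Seq (Arith Mul 11 11 0) (Seq (Arith Sub 11 11 3) (Seq (query_at query 11)
     (Seq (Arith Add 11 12 4) (Seq (Arith Add 11 11 3) (Seq (Arith Less 11 11 16)
     (Seq (Arith Add 8 10 0) (Seq (Arith Add 8 8 4) (Store 8 11)))))))))))"

definition omv_answer :: "com \<Rightarrow> com \<Rightarrow> com" where
  "omv_answer create query =
     Seq (for_to 0 (fill_body create True)) (Seq (for_to 0 (query_body query))
     (Seq (for_to 0 (fill_body create False)) (Arith Add 12 12 3)))"

text \<open>\<open>B\<close> and \<open>B'\<close> bound the words of the structure on
  \<open>4 * n\<close> vertices and of the surrounding program. The first condition on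
  \<open>B'\<close> makes room for shifted addresses, the second for time stamps, which stay below
  \<open>4 * n * n\<close>.\<close>

locale reduction =
  fixes n B B' U Q :: nat and create query :: com and M :: "nat \<Rightarrow> nat \<Rightarrow> bool"
  assumes n: "1 \<le> n" and B: "4 * n < B"
    and B': "B + (n * n + 2 * n) \<le> B'" "5 * (n * n) + 5 * n + 5 \<le> B'"
begin

section \<open>Single operations of the embedded structure\<close>

abbreviation d :: nat where "d \<equiv> n * n + 2 * n"

text \<open>Quantifying over all continuations turns correctness on a given list of operations into
  an invariant of the state.\<close>

definition good :: "state \<Rightarrow> (edge \<times> real) set \<Rightarrow> bool" where
  "good s S \<longleftrightarrow> (\<forall>ops. serves B (4 * n) create query U Q ops s S)"

definition holds :: "(edge \<times> real) set \<Rightarrow> state \<Rightarrow> bool" where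
  "holds S z \<longleftrightarrow> (\<exists>s. sim d s z \<and> words B s \<and> good s S)"

text \<open>Each continuation provides a run of \<open>create\<close>, and by determinism all these
  runs agree; so one successor state is good for every continuation.\<close>

lemma good_create:
  assumes "good s S" "can_insert (4 * n) S {u, v} t"
  obtains x s' where "exec B create (set_rreg 0 t (set_reg 1 v (set_reg 0 u s))) x s'" "x \<le> U"
    "good s' (insert ({u, v}, t) S)"
proof -
  let ?s = "set_rreg 0 t (set_reg 1 v (set_reg 0 u s))"
  have *: "\<exists>x s'. exec B create ?s x s' \<and> x \<le> U \<and>
      serves B (4 * n) create query U Q ops s' (insert ({u, v}, t) S)" for ops
  proof -
    have "serves B (4 * n) create query U Q (Create (Insert u v) t # ops) s S"
      using assms(1) unfolding good_def by blast
    then show ?thesis using assms(2) unfolding serves.simps by blast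
  qed
  obtain x s' where s': "exec B create ?s x s'" "x \<le> U" using * by blast
  then have "good s' (insert ({u, v}, t) S)"
    unfolding good_def using * exec_deterministic by metis
  with s' that show thesis by blast
qed

lemma good_query:
  assumes "good s S"
  obtains x s' where "exec B query (set_rreg 0 t s) x s'" "x \<le> Q"
    "reg s' 0 = max_degree (4 * n) (graph_at S t)" "good s' S"
proof -
  have *: "\<exists>x s'. exec B query (set_rreg 0 t s) x s' \<and> x \<le> Q \<and>
      reg s' 0 = max_degree (4 * n) (graph_at S t) \<and> serves B (4 * n) create query U Q ops s' S" for ops
  proof -
    have "serves B (4 * n) create query U Q (Query t # ops) s S"
      using assms(1) unfolding good_def by blast
    then show ?thesis unfolding serves.simps by blast
  qed
  obtain x s' where s': "exec B query (set_rreg 0 t s) x s'" "x \<le> Q"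
    "reg s' 0 = max_degree (4 * n) (graph_at S t)" using * by blast
  then have "good s' S"
    unfolding good_def using * exec_deterministic by metis
  with s' that show thesis by blast
qed

text \<open>Passing the parameters costs 3 steps and the relocated run at most \<open>2 * U\<close>.
  Legality bounds the vertices by \<open>4 * n < B\<close>, so they are words of the
  structure.\<close>

lemma wp_insert_at:
  assumes "holds S z" and can: "can_insert (4 * n) S {reg z a, reg z b} (real (reg z c))"
    and "a < 16" "b < 16" "c < 16"
    and R: "\<And>z' t'. holds (insert ({reg z a, reg z b}, real (reg z c)) S) z' \<Longrightarrow> frame d z z' \<Longrightarrow>
      t' \<le> t + (2 * U + 3) \<Longrightarrow> R z' t'"
  shows "wp B' (insert_at create a b c) z t R"
proof -
  let ?u = "reg z a" let ?v = "reg z b" let ?\<tau> = "real (reg z c)"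
  obtain s where s: "sim d s z" "words B s" "good s S" using assms(1) by (auto simp: holds_def)
  let ?s = "set_rreg 0 ?\<tau> (set_reg 1 ?v (set_reg 0 ?u s))"
  let ?z = "set_rreg 0 ?\<tau> (set_reg 17 ?v (set_reg 16 ?u z))"
  have uv: "?u < B" "?v < B" using can B by (auto simp: can_insert_def)
  obtain x s' where s': "exec B create ?s x s'" "x \<le> U" "good s' (insert ({?u, ?v}, ?\<tau>) S)"
    using good_create s(3) can by blast
  have w: "words B ?s" using s(2) uv by (auto simp: words_def)
  have "sim d ?s ?z" using s(1) by (auto simp: sim_def)
  then have "wp B' (relocate create) ?z (t + 3) R"
  proof (rule wp_mono[OF wp_relocate[OF s'(1)]])
    show "words B ?s" "2 \<le> B" "B + d \<le> B'" using w B B' n by auto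
    fix z' t' assume *: "sim d s' z' \<and> frame d ?z z' \<and> t' \<le> t + 3 + 2 * x"
    have "words B s'" using exec_words[OF s'(1) _ w] B n by simp
    with * s'(3) have "holds (insert ({?u, ?v}, ?\<tau>) S) z'" by (auto simp: holds_def)
    moreover have "frame d z z'" using * by (simp add: frame_def)
    ultimately show "R z' t'" using R * s'(2) by simp
  qed
  then show ?thesis
    using uv B' assms(3-5) by (simp add: insert_at_def numeral_eq_Suc)
qed

lemma wp_query_at:
  assumes "holds S z" and "c < 16"
    and R: "\<And>z' t'. holds S z' \<Longrightarrow> frame d z z' \<Longrightarrow>
      reg z' 16 = max_degree (4 * n) (graph_at S (real (reg z c))) \<Longrightarrow> t' \<le> t + (2 * Q + 1) \<Longrightarrow> R z' t'"
  shows "wp B' (query_at query c) z t R"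
proof -
  let ?\<tau> = "real (reg z c)"
  obtain s where s: "sim d s z" "words B s" "good s S" using assms(1) by (auto simp: holds_def)
  let ?s = "set_rreg 0 ?\<tau> s" let ?z = "set_rreg 0 ?\<tau> z"
  obtain x s' where s': "exec B query ?s x s'" "x \<le> Q"
      "reg s' 0 = max_degree (4 * n) (graph_at S ?\<tau>)" "good s' S"
    using good_query s(3) by blast
  have w: "words B ?s" using s(2) by (auto simp: words_def)
  have "sim d ?s ?z" using s(1) by (auto simp: sim_def)
  then have "wp B' (relocate query) ?z (Suc t) R"
  proof (rule wp_mono[OF wp_relocate[OF s'(1)]])
    show "words B ?s" "2 \<le> B" "B + d \<le> B'" using w B B' n by auto
    fix z' t' assume *: "sim d s' z' \<and> frame d ?z z' \<and> t' \<le> Suc t + 2 * x"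
    have "words B s'" using exec_words[OF s'(1) _ w] B n by simp
    with * s'(4) have "holds S z'" by (auto simp: holds_def)
    moreover have "frame d z z'" using * by (simp add: frame_def)
    moreover have "reg z' (16 + 0) = reg s' 0" using * unfolding sim_def by blast
    ultimately show "R z' t'" using R * s'(2,3) by simp
  qed
  then show ?thesis by (simp add: query_at_def)
qed

lemma holds_cong:
  assumes "holds S z" "\<And>a. 16 \<le> a \<Longrightarrow> reg z' a = reg z a" "reg z' 1 = reg z 1"
    "\<And>x. d \<le> x \<Longrightarrow> mem z' x = mem z x" "rreg z' = rreg z" "rmem z' = rmem z"
  shows "holds S z'"
  using assms unfolding holds_def sim_def by simp

text \<open>The state between operations: \<open>A\<close> collects the inserted pairs of main
  vertex and column, and \<open>k\<close> is the column for the current vector. Counters and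
  temporaries are left free.\<close>

definition ready :: "(nat \<times> nat) set \<Rightarrow> nat \<Rightarrow> state \<Rightarrow> bool" where
  "ready A k z \<longleftrightarrow> holds (timed_edge n M ` A) z \<and>
     reg z 0 = n \<and> reg z 3 = 1 \<and> reg z 10 = n * n \<and> reg z 12 = k \<and>
     (\<forall>x<n * n. mem z x = of_bool (M (x div n) (x mod n)))"

text \<open>The arbitrary register contents \<open>f\<close> let the simplifier strip a chain of
  updates one by one.\<close>

lemma ready_set_reg [simp]:
  assumes "a \<in> {4, 5, 6, 7, 8, 11}"
  shows "ready A k (z\<lparr>reg := f(a := x)\<rparr>) \<longleftrightarrow> ready A k (z\<lparr>reg := f\<rparr>)"
proof -
  have "holds S (z\<lparr>reg := f(a := x)\<rparr>) \<longleftrightarrow> holds S (z\<lparr>reg := f\<rparr>)" for S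
    by (intro iffI; erule holds_cong) (use assms in auto)
  then show ?thesis using assms by (auto simp: ready_def)
qed

lemma ready_mem_cong:
  assumes "ready A k z" "\<And>x. x < n * n \<or> d \<le> x \<Longrightarrow> f x = mem z x"
  shows "ready A k (z\<lparr>mem := f\<rparr>)"
proof -
  have "holds S (z\<lparr>mem := f\<rparr>)" if "holds S z" for S
    using that by (rule holds_cong) (use assms in auto)
  then show ?thesis using assms by (auto simp: ready_def)
qed

lemma wp_insert_edge:
  assumes z: "ready A k z" and A: "A \<subseteq> {..<n} \<times> {..<3 * n}" "j < n" "c < 3 * n" "(j, c) \<notin> A"
    and regs: "reg z a = j" "reg z b = n + c" "reg z e = ins_time n M j c" "a < 16" "b < 16" "e < 16"
    and R: "\<And>z' t'. ready (insert (j, c) A) k z' \<Longrightarrow> frame d z z' \<Longrightarrow> t' \<le> t + (2 * U + 3) \<Longrightarrow> R z' t'"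
  shows "wp B' (insert_at create a b e) z t R"
proof (rule wp_insert_at)
  show "holds (timed_edge n M ` A) z" using z by (simp add: ready_def)
  show "can_insert (4 * n) (timed_edge n M ` A) {reg z a, reg z b} (real (reg z e))"
    using can_insert_timed_edge[OF A] regs by simp
  fix z' t'
  assume h: "holds (insert ({reg z a, reg z b}, real (reg z e)) (timed_edge n M ` A)) z'"
    and f: "frame d z z'" and t: "t' \<le> t + (2 * U + 3)"
  have "timed_edge n M (j, c) = ({reg z a, reg z b}, real (reg z e))"
    by (simp add: timed_edge_def regs)
  with h f z have "ready (insert (j, c) A) k z'" by (simp add: ready_def frame_def)
  then show "R z' t'" using f t R by blast
qed fact+

section \<open>Word sizes and the preparation phase\<close>

lemma small:
  assumes "k \<le> 4 * n + 1" "j < n"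
  shows "k * n + j < B'" "k * n < B'"
proof -
  have "k * n \<le> (4 * n + 1) * n" using assms by (intro mult_le_mono1)
  also have "\<dots> = 4 * (n * n) + n" by (simp add: algebra_simps)
  finally show "k * n + j < B'" "k * n < B'" using B'(2) assms n by linarith+
qed

lemma small_linear: "x \<le> 5 * n + 4 \<Longrightarrow> x < B'" "x \<le> n * n + 5 * n \<Longrightarrow> x < B'"
  using B'(2) n by linarith+

text \<open>One counter over the matrix entries enumerates both the lifting edges (first image) and
  the row edges (second image).\<close>

definition prep_set :: "nat \<Rightarrow> (nat \<times> nat) set" where
  "prep_set p = (\<lambda>q. (q mod n, q div n)) ` {..<p} \<union> (\<lambda>q. (q mod n, 2 * n + q div n)) ` {..<p}"

lemma prep_set_full: "prep_set (n * n) = filled n n"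
proof
  show "prep_set (n * n) \<subseteq> filled n n"
    using n by (auto simp: prep_set_def filled_def less_mult_imp_div_less)
  show "filled n n \<subseteq> prep_set (n * n)"
  proof
    fix x assume "x \<in> filled n n"
    then obtain j y where "x = (j, y)" "j < n" "y < n \<or> 2 * n \<le> y \<and> y < 3 * n"
      by (auto simp: filled_def)
    then obtain c where x: "j < n" "c < n" "x = (j, c) \<or> x = (j, 2 * n + c)"
      using le_Suc_ex[of "2 * n" y] by auto
    let ?q = "c * n + j"
    have "Suc c * n \<le> n * n" using x by (intro mult_le_mono1) simp
    then have "?q < n * n" "?q mod n = j" "?q div n = c" using x by simp_all
    then show "x \<in> prep_set (n * n)" using x(3) unfolding prep_set_def
      by (metis (no_types, lifting) UnI1 UnI2 image_eqI lessThan_iff)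
  qed
qed

lemma prep_set_Suc:
  "prep_set (Suc p) = insert (p mod n, 2 * n + p div n) (insert (p mod n, p div n) (prep_set p))"
  by (auto simp: prep_set_def lessThan_Suc)

text \<open>Quotient and remainder determine the counter, and since the quotient is below
  \<open>n\<close>, lifting columns and row columns never meet.\<close>

lemma prep_set_fresh:
  assumes "p < n * n"
  shows "prep_set p \<subseteq> {..<n} \<times> {..<3 * n}" "(p mod n, p div n) \<notin> prep_set p"
    "(p mod n, 2 * n + p div n) \<notin> prep_set p"
proof -
  have dv: "q div n < n" if "q \<le> p" for q using that assms by (simp add: less_mult_imp_div_less)
  show "prep_set p \<subseteq> {..<n} \<times> {..<3 * n}"
  proof
    fix x assume "x \<in> prep_set p"
    then obtain q where "q < p" "x = (q mod n, q div n) \<or> x = (q mod n, 2 * n + q div n)"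
      unfolding prep_set_def by blast
    then show "x \<in> {..<n} \<times> {..<3 * n}" using dv[of q] n by auto
  qed
  have inj: "q = p" if "q mod n = p mod n" "q div n = p div n" for q
    using that by (metis div_mult_mod_eq)
  show "(p mod n, p div n) \<notin> prep_set p"
    using inj dv[of p] by (fastforce simp: prep_set_def)
  show "(p mod n, 2 * n + p div n) \<notin> prep_set p"
  proof
    assume "(p mod n, 2 * n + p div n) \<in> prep_set p"
    then obtain q where "q < p" "q mod n = p mod n" "q div n = 2 * n + p div n \<or> q div n = p div n"
      unfolding prep_set_def by auto
    then show False using dv[of q] inj[of q] by auto
  qed
qed

text \<open>Eleven instructions surround two insertions of at most \<open>2 * U + 3\<close> steps;
  the bound is rounded up.\<close>

lemma wp_prep_body:
  assumes p: "p < n * n" "reg z 4 = p" and z: "ready (prep_set p) n z"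
  shows "wp B' (prep_body create) z t (\<lambda>z' t'. ready (prep_set (Suc p)) n z' \<and> reg z' 4 = p \<and>
    t' \<le> t + (4 * U + 20))"
proof -
  have r: "reg z 0 = n" "reg z 3 = 1" using z by (simp_all add: ready_def)
  let ?j = "p mod n" let ?c = "p div n"
  have jc: "?j < n" "?c < n" using p n by (simp_all add: less_mult_imp_div_less)
  have c: "2 * n + ?c < 3 * n" using jc by simp
  have it1: "ins_time n M ?j ?c = p" using jc by (simp add: ins_time_def slot_def)
  \<comment> \<open>The slot is brought into the shape in which register 11 accumulates it, by
    doubling \<open>n + ?c\<close>.\<close>
  have "2 * (2 * n + ?c) + 1 - 2 * n = n + ?c + (n + ?c) + 1" by simp
  then have "slot n M ?j (2 * n + ?c) = n + ?c + (n + ?c) + 1 - of_bool (M ?c ?j)"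
    unfolding slot_def by (simp only: add_diff_cancel_left' if_False not_add_less1)
  then have it2: "ins_time n M ?j (2 * n + ?c) = (n + ?c + (n + ?c) + 1 - of_bool (M ?c ?j)) * n + ?j"
    by (simp only: ins_time_def)
  note fresh = prep_set_fresh[OF p(1)]
  have pB: "p < B'" using p B'(2) by linarith
  have sl: "(n + ?c + (n + ?c) + 1 - of_bool (M ?c ?j)) * n + ?j < B'"
    "(n + ?c + (n + ?c) + 1 - of_bool (M ?c ?j)) * n < B'"
    by (rule small[OF _ jc(1)]; use jc in simp)+
  let ?z1 = "z\<lparr>reg := (reg z)(6 := ?j, 7 := n + ?c)\<rparr>"
  have "wp B' (insert_at create 6 7 4) ?z1 (Suc (Suc (Suc t))) (\<lambda>z' t'. wp B'
     (Seq (Load 8 4) (Seq (Arith Add 11 7 7) (Seq (Arith Add 11 11 3) (Seq (Arith Sub 11 11 8)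
     (Seq (Arith Mul 11 11 0) (Seq (Arith Add 11 11 6)
     (Seq (Arith Add 7 7 0) (Seq (Arith Add 7 7 0)
     (insert_at create 6 7 11))))))))) z' t'
     (\<lambda>z' t'. ready (prep_set (Suc p)) n z' \<and> reg z' 4 = p \<and> t' \<le> t + (4 * U + 20)))"
  proof (rule wp_insert_edge[of "prep_set p" n ?z1 ?j ?c])
    fix z2 t2
    assume z2: "ready (insert (?j, ?c) (prep_set p)) n z2" "frame d ?z1 z2"
      "t2 \<le> Suc (Suc (Suc t)) + (2 * U + 3)"
    have r2: "reg z2 0 = n" "reg z2 3 = 1" "reg z2 4 = p" "reg z2 6 = ?j" "reg z2 7 = n + ?c"
        "mem z2 p = of_bool (M ?c ?j)"
      using z2 r p by (simp_all add: ready_def frame_def)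
    let ?z3 = "z2\<lparr>reg := (reg z2)(8 := of_bool (M ?c ?j),
      11 := (n + ?c + (n + ?c) + 1 - of_bool (M ?c ?j)) * n + ?j, 7 := n + ?c + n + n)\<rparr>"
    have "wp B' (insert_at create 6 7 11) ?z3 (Suc (Suc (Suc (Suc (Suc (Suc (Suc (Suc t2))))))))
        (\<lambda>z' t'. ready (prep_set (Suc p)) n z' \<and> reg z' 4 = p \<and> t' \<le> t + (4 * U + 20))"
    proof (rule wp_insert_edge[of "insert (?j, ?c) (prep_set p)" n ?z3 ?j "2 * n + ?c"])
      show "insert (?j, ?c) (prep_set p) \<subseteq> {..<n} \<times> {..<3 * n}" using fresh jc by auto
      show "(?j, 2 * n + ?c) \<notin> insert (?j, ?c) (prep_set p)" using fresh n by auto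
      fix z4 t4
      assume "ready (insert (?j, 2 * n + ?c) (insert (?j, ?c) (prep_set p))) n z4" "frame d ?z3 z4"
        "t4 \<le> Suc (Suc (Suc (Suc (Suc (Suc (Suc (Suc t2))))))) + (2 * U + 3)"
      then show "ready (prep_set (Suc p)) n z4 \<and> reg z4 4 = p \<and> t4 \<le> t + (4 * U + 20)"
        using z2(3) r2 by (simp add: prep_set_Suc frame_def)
    qed (use z2 c jc r2 it2 in simp_all)
    moreover have "n + ?c + n + n < B'" "n + ?c + n < B'" "n + ?c + (n + ?c) + 1 < B'"
      using jc by (intro small_linear; simp)+
    ultimately show "wp B'
     (Seq (Load 8 4) (Seq (Arith Add 11 7 7) (Seq (Arith Add 11 11 3) (Seq (Arith Sub 11 11 8)
     (Seq (Arith Mul 11 11 0) (Seq (Arith Add 11 11 6)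
     (Seq (Arith Add 7 7 0) (Seq (Arith Add 7 7 0)
     (insert_at create 6 7 11))))))))) z2 t2
     (\<lambda>z' t'. ready (prep_set (Suc p)) n z' \<and> reg z' 4 = p \<and> t' \<le> t + (4 * U + 20))"
      using sl by (simp add: r2 fun_upd_twist)
  qed (use z fresh jc r p it1 in simp_all)
  moreover have "n + ?c < B'" "?c < B'" "?j < B'"
    using jc by - (rule small_linear(1), linarith)+
  ultimately show ?thesis using r p by (simp add: prep_body_def add.commute)
qed


section \<open>Processing one vector\<close>

lemma wp_fill:
  assumes z: "ready A k z" and vec: "\<And>j. j < n \<Longrightarrow> mem z (n * n + j) = of_bool (v j)"
    and k: "k < 2 * n" and A: "A \<subseteq> {..<n} \<times> {..<3 * n}"
    and fresh: "\<And>j. j < n \<Longrightarrow> v j = pos \<Longrightarrow> (j, k) \<notin> A"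
    and R: "\<And>z' t'. ready (A \<union> {(j, k) |j. j < n \<and> v j = pos}) k z' \<Longrightarrow>
      (\<And>x. x < d \<Longrightarrow> mem z' x = mem z x) \<Longrightarrow> t' \<le> t + n * (2 * U + 18) + 3 \<Longrightarrow> R z' t'"
  shows "wp B' (for_to 0 (fill_body create pos)) z t R"
proof (rule wp_for_to[where m = n and C = "2 * U + 15" and
      I = "\<lambda>p z'. ready (A \<union> {(j, k) |j. j < p \<and> v j = pos}) k z' \<and> (\<forall>x<d. mem z' x = mem z x)"])
  let ?A = "\<lambda>p. A \<union> {(j, k) |j. j < p \<and> v j = pos}"
  let ?I = "\<lambda>p z'. ready (?A p) k z' \<and> (\<forall>x<d. mem z' x = mem z x)"
  show "n < B'" "1 < B'" by (rule small_linear(1), simp)+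
  show "reg s 3 = 1 \<and> reg s 0 = n" if "?I p s" for p s using that by (simp add: ready_def)
  show "?I p (s\<lparr>reg := (reg s)(4 := x, 5 := y)\<rparr>)" if "?I p s" for p s x y using that by simp
  show "?I 0 z" using z by simp
  show "R z' t'" if "?I n z'" "t' \<le> t + n * (2 * U + 15 + 3) + 3" for z' t'
    using that by (intro R) (simp_all add: algebra_simps)
  fix p s t
  assume p: "p < n" and I: "?I p s" and s4: "reg s 4 = p"
  let ?P = "\<lambda>s' t'. ?I (Suc p) s' \<and> reg s' 4 = p \<and> t' \<le> t + (2 * U + 15)"
  have r: "reg s 0 = n" "reg s 10 = n * n" "reg s 12 = k" using I by (simp_all add: ready_def)
  have m: "mem s (n * n + p) = of_bool (v p)" using I p vec by simp
  have skip: "?P (s\<lparr>reg := (reg s)(8 := 0)\<rparr>) (Suc (Suc (Suc (Suc t))))" if "v p \<noteq> pos"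
  proof -
    have "?A (Suc p) = ?A p" using that by (auto simp: less_Suc_eq)
    then show ?thesis using I s4 by simp
  qed
  let ?s = "s\<lparr>reg := (reg s)(8 := of_bool (v p), 7 := k + n, 11 := k * n + p)\<rparr>"
  have ins: "wp B' (insert_at create 4 7 11) ?s (Suc (Suc (Suc (Suc (Suc (Suc t)))))) ?P" if vp: "v p = pos"
  proof (rule wp_insert_edge[where A = "?A p" and j = p and c = k])
    show "?A p \<subseteq> {..<n} \<times> {..<3 * n}" using A k p by auto
    show "(p, k) \<notin> ?A p" using fresh[OF p vp] by simp
    fix s' t'
    assume s': "ready (insert (p, k) (?A p)) k s'" "frame d ?s s'"
      "t' \<le> Suc (Suc (Suc (Suc (Suc (Suc t))))) + (2 * U + 3)"
    have "insert (p, k) (?A p) = ?A (Suc p)" using vp by (auto simp: less_Suc_eq)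
    then show "?P s' t'" using s' I s4 by (simp add: frame_def)
  qed (use I p k s4 in \<open>simp_all add: ins_time_def slot_def\<close>)
  have "k * n + p < B'" "k * n < B'" using k p by (intro small[of k p]; simp)+
  moreover have "k + n < B'" using k by (intro small_linear(1)) simp
  moreover have "n * n + p < B'" using p by (intro small_linear(2)) simp
  ultimately show "wp B' (fill_body create pos) s t ?P"
    using skip ins B' s4 by (cases "v p"; cases pos)
      (simp_all add: fill_body_def r m fun_upd_twist del: One_nat_def)
qed

text \<open>Queries leave the insertions unchanged, and the output cells lie between the vector and
  the memory of the structure, so the vector survives for the second filling pass.\<close>

lemma wp_queries:
  fixes r :: nat and v :: "nat \<Rightarrow> bool"
  defines "A \<equiv> filled n (n + r) \<union> {(j, n + r) |j. j < n \<and> v j}"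
  assumes z: "ready A (n + r) z" and r: "r < n"
    and R: "\<And>z' t'. ready A (n + r) z' \<Longrightarrow> (\<And>x. x < n * n + n \<Longrightarrow> mem z' x = mem z x) \<Longrightarrow>
      shows_vector n (bool_mat_vec n M v) z' \<Longrightarrow> t' \<le> t + n * (2 * Q + 18) + 3 \<Longrightarrow> R z' t'"
  shows "wp B' (for_to 0 (query_body query)) z t R"
proof (rule wp_for_to[where m = n and C = "2 * Q + 15" and
      I = "\<lambda>p z'. ready A (n + r) z' \<and> (\<forall>x<n * n + n. mem z' x = mem z x) \<and>
        (\<forall>i<p. mem z' (n * n + n + i) = of_bool (bool_mat_vec n M v i))"])
  let ?I = "\<lambda>p z'. ready A (n + r) z' \<and> (\<forall>x<n * n + n. mem z' x = mem z x) \<and>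
        (\<forall>i<p. mem z' (n * n + n + i) = of_bool (bool_mat_vec n M v i))"
  show "n < B'" "1 < B'" by (rule small_linear(1), simp)+
  show "reg s 3 = 1 \<and> reg s 0 = n" if "?I p s" for p s using that by (simp add: ready_def)
  show "?I p (s\<lparr>reg := (reg s)(4 := x, 5 := y)\<rparr>)" if "?I p s" for p s x y using that by simp
  show "?I 0 z" using z by simp
  show "R z' t'" if "?I n z'" "t' \<le> t + n * (2 * Q + 15 + 3) + 3" for z' t'
    using that by (intro R) (simp_all add: shows_vector_def algebra_simps)
  fix p s t
  assume p: "p < n" and I: "?I p s" and s4: "reg s 4 = p"
  let ?P = "\<lambda>s' t'. ?I (Suc p) s' \<and> reg s' 4 = p \<and> t' \<le> t + (2 * Q + 15)"
  let ?rest = "Seq (Arith Add 11 12 4) (Seq (Arith Add 11 11 3) (Seq (Arith Less 11 11 16)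
     (Seq (Arith Add 8 10 0) (Seq (Arith Add 8 8 4) (Store 8 11)))))"
  have rs: "reg s 0 = n" "reg s 3 = 1" using I by (simp_all add: ready_def)
  \<comment> \<open>The last time of slot \<open>2 * n + 2 * p\<close>, which holds the ones of row
    \<open>p\<close>.\<close>
  define w where "w = (n + p + (n + p) + 1) * n - 1"
  let ?s = "s\<lparr>reg := (reg s)(11 := w)\<rparr>"
  have "wp B' (query_at query 11) ?s (Suc (Suc (Suc (Suc (Suc t))))) (\<lambda>s' t'. wp B' ?rest s' t' ?P)"
  proof (rule wp_query_at)
    have "ready A (n + r) ?s" using I by simp
    then show "holds (timed_edge n M ` A) ?s" unfolding ready_def by blast
    fix s' t'
    assume s': "holds (timed_edge n M ` A) s'" "frame d ?s s'"
      "reg s' 16 = max_degree (4 * n) (graph_at (timed_edge n M ` A) (real (reg ?s 11)))"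
      "t' \<le> Suc (Suc (Suc (Suc (Suc t)))) + (2 * Q + 1)"
    have "n + p + (n + p) + 1 = 2 * n + 2 * p + 1" by simp
    then have "reg ?s 11 = (2 * n + 2 * p + 1) * n - 1" by (simp only: w_def) simp
    then have ans: "n + r + p + 1 < reg s' 16 \<longleftrightarrow> bool_mat_vec n M v p"
      unfolding s'(3) using query_answer[OF r p, of M v] by (simp only: A_def)
    have rd: "ready A (n + r) s'" using s'(1,2) I by (simp add: ready_def frame_def)
    then have rs': "reg s' 0 = n" "reg s' 3 = 1" "reg s' 10 = n * n" "reg s' 12 = n + r"
      by (simp_all add: ready_def)
    have s4': "reg s' 4 = p" using s'(2) s4 by (simp add: frame_def)
    have m: "mem s' x = mem s x" if "x < d" for x using s'(2) that by (simp add: frame_def)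
    let ?b = "of_bool (bool_mat_vec n M v p)"
    let ?e = "s'\<lparr>reg := (reg s')(8 := n * n + n + p, 11 := ?b), mem := (mem s')(n * n + n + p := ?b)\<rparr>"
    have "ready A (n + r) (s'\<lparr>reg := (reg s')(8 := n * n + n + p, 11 := ?b)\<rparr>)" using rd by simp
    then have "ready A (n + r) ?e"
      by (drule_tac f = "(mem s')(n * n + n + p := ?b)" in ready_mem_cong) (use p in auto)
    moreover have "mem ?e x = mem z x" if "x < n * n + n" for x
      using that I m by simp
    moreover have "mem s' (n * n + n + i) = of_bool (bool_mat_vec n M v i)" if "i < Suc p" "i \<noteq> p" for i
      using that I m p by simp
    moreover have "n + r + p < B'" "n + r + p + 1 < B'" by (rule small_linear(1), use r p in simp)+
    moreover have "n * n + n < B'" "n * n + n + p < B'" by (rule small_linear(2), use p in simp)+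
    ultimately show "wp B' ?rest s' t' ?P"
      using ans s'(4) s4' B' by (simp add: rs' fun_upd_twist)
  qed simp
  moreover have "(n + p + (n + p) + 1) * n < B'" by (rule small(2)[OF _ p], use p in simp)
  moreover have "n + p < B'" "n + p + (n + p) < B'" "n + p + (n + p) + 1 < B'"
    by (rule small_linear(1), use p in simp)+
  ultimately show "wp B' (query_body query) s t ?P"
    unfolding w_def by (simp add: query_body_def rs s4)
qed

text \<open>The time is the sum for two filling loops and one query loop, each with overhead 3, and
  the final increment.\<close>

lemma wp_answer:
  assumes z: "ready (filled n (n + r)) (n + r) z" and r: "r < n"
  shows "wp B' (omv_answer create query) (give_vector n v z) t
    (\<lambda>z' t'. ready (filled n (n + Suc r)) (n + Suc r) z' \<and> shows_vector n (bool_mat_vec n M v) z' \<and>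
      t' \<le> t + n * (4 * U + 2 * Q + 54) + 10)" (is "wp _ _ _ _ ?R")
proof -
  let ?F = "filled n (n + r)"
  let ?V = "\<lambda>b. {(j, n + r) |j. j < n \<and> v j = b}"
  let ?A = "?F \<union> ?V True"
  let ?z = "give_vector n v z"
  have F: "?A \<subseteq> {..<n} \<times> {..<3 * n}" using r by (auto simp: filled_def)
  have fresh: "(j, n + r) \<notin> ?F" for j using r by (simp add: filled_def)
  have "ready ?F (n + r) ?z"
    unfolding give_vector_def by (rule ready_mem_cong[OF z]) auto
  moreover have vec: "mem ?z (n * n + j) = of_bool (v j)" if "j < n" for j
    using that by (simp add: give_vector_def)
  ultimately have "wp B' (for_to 0 (fill_body create True)) ?z t
     (\<lambda>z' t'. wp B' (for_to 0 (query_body query)) z' t'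
     (\<lambda>z' t'. wp B' (for_to 0 (fill_body create False)) z' t'
     (\<lambda>z' t'. wp B' (Arith Add 12 12 3) z' t' ?R)))"
  proof (rule wp_fill[where v = v])
    fix z1 t1
    assume z1: "ready ?A (n + r) z1" "\<And>x. x < d \<Longrightarrow> mem z1 x = mem ?z x"
      "t1 \<le> t + n * (2 * U + 18) + 3"
    have A: "?A = ?F \<union> {(j, n + r) |j. j < n \<and> v j}" by simp
    show "wp B' (for_to 0 (query_body query)) z1 t1
     (\<lambda>z' t'. wp B' (for_to 0 (fill_body create False)) z' t'
     (\<lambda>z' t'. wp B' (Arith Add 12 12 3) z' t' ?R))"
    proof (rule wp_queries[OF z1(1)[unfolded A] r], unfold A[symmetric])
      fix z2 t2
      assume z2: "ready ?A (n + r) z2" "\<And>x. x < n * n + n \<Longrightarrow> mem z2 x = mem z1 x"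
        "shows_vector n (bool_mat_vec n M v) z2" "t2 \<le> t1 + n * (2 * Q + 18) + 3"
      show "wp B' (for_to 0 (fill_body create False)) z2 t2
        (\<lambda>z' t'. wp B' (Arith Add 12 12 3) z' t' ?R)"
      proof (rule wp_fill[where v = v])
        show "ready ?A (n + r) z2" by fact
        show "mem z2 (n * n + j) = of_bool (v j)" if "j < n" for j
          using that vec[OF that] z1(2) z2(2) by simp
        show "?A \<subseteq> {..<n} \<times> {..<3 * n}" by fact
        \<comment> \<open>The first pass touched this column only at the ones, so the zeros are
          still fresh.\<close>
        show "(j, n + r) \<notin> ?A" if "v j = False" for j using fresh that by auto
        show "n + r < 2 * n" using r by simp
        fix z3 t3
        assume z3: "ready (?A \<union> ?V False) (n + r) z3" "\<And>x. x < d \<Longrightarrow> mem z3 x = mem z2 x"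
          "t3 \<le> t2 + n * (2 * U + 18) + 3"
        \<comment> \<open>Both passes together complete column \<open>n + r\<close>, restoring equal
          degrees for the next round.\<close>
        have "?A \<union> ?V False = filled n (n + Suc r)" by (auto simp: filled_def)
        with z3(1) have rd: "ready (filled n (n + Suc r)) (n + r) z3" by simp
        let ?z4 = "set_reg 12 (Suc (n + r)) z3"
        have rg: "reg z3 12 = n + r" "reg z3 3 = 1" using rd by (simp_all add: ready_def)
        have "holds S ?z4" if "holds S z3" for S using that by (rule holds_cong) auto
        then have "ready (filled n (n + Suc r)) (n + Suc r) ?z4" using rd by (simp add: ready_def)
        moreover have "shows_vector n (bool_mat_vec n M v) ?z4"
          using z2(3) z3(2) by (simp add: shows_vector_def)
        moreover have "Suc t3 \<le> t + n * (4 * U + 2 * Q + 54) + 10"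
          using z1(3) z2(4) z3(3) by (simp add: algebra_simps)
        moreover have "Suc (n + r) < B'" by (rule small_linear(1), use r in simp)
        ultimately show "wp B' (Arith Add 12 12 3) z3 t3 ?R" by (simp add: rg)
      qed
    qed
  qed (use r fresh F in auto)
  then show ?thesis by (simp add: omv_answer_def)
qed

text \<open>Each round consumes at most one of the \<open>length vs\<close> equal shares of the
  budget, so the remaining time suffices for the remaining vectors.\<close>

lemma omv_rounds_answer:
  assumes "ready (filled n (n + r)) (n + r) z" "r + length vs \<le> n"
    "length vs * (n * (4 * U + 2 * Q + 54) + 10) \<le> T"
  shows "omv_rounds B' n M (omv_answer create query) T vs z"
  using assms
proof (induction vs arbitrary: r z T)
  case (Cons v vs)
  then have "r < n" by simp
  from wp_answer[OF Cons.prems(1) this, of v 0] obtain x z' where z':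
    "exec B' (omv_answer create query) (give_vector n v z) x z'"
    "ready (filled n (n + Suc r)) (n + Suc r) z'" "shows_vector n (bool_mat_vec n M v) z'"
    "x \<le> n * (4 * U + 2 * Q + 54) + 10"
    unfolding wp_def by auto
  have "omv_rounds B' n M (omv_answer create query) (T - x) vs z'"
    by (rule Cons.IH[OF z'(2)]) (use Cons.prems z'(4) in auto)
  moreover have "x \<le> T" using Cons.prems(3) z'(4) by simp
  ultimately show ?case using z' by auto
qed simp

lemma wp_prep:
  assumes init: "exec B init (start (4 * n)) x s" "x \<le> P" "good s {}"
  shows "wp B' (omv_prep init create) (omv_start n M) 0
    (\<lambda>z' t'. ready (filled n n) n z' \<and> t' \<le> 2 * P + n * n * (4 * U + 23) + 10)" (is "wp _ _ _ _ ?R")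
proof -
  let ?z = "(omv_start n M)\<lparr>reg := (\<lambda>_. 0)(0 := n, 3 := 1, 10 := n * n, 1 := n * n + n + n,
    12 := n, 16 := n + n + (n + n))\<rparr>"
  have w: "words B (start (4 * n))" using B by (auto simp: words_def start_def)
  \<comment> \<open>The matrix occupies only cells below \<open>n * n\<close>; from \<open>d\<close>
    on the memory is still zero, as a fresh start requires.\<close>
  have "sim d (start (4 * n)) ?z"
    by (auto simp: sim_def start_def omv_start_def)
  then have "wp B' (relocate init) ?z 7 (\<lambda>z' t'. wp B' (for_to 10 (prep_body create)) z' t' ?R)"
  proof (rule wp_mono[OF wp_relocate[OF init(1)]])
    show "words B (start (4 * n))" "2 \<le> B" "B + d \<le> B'" using w B B' n by auto
    fix z t assume z: "sim d s z \<and> frame d ?z z \<and> t \<le> 7 + 2 * x"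
    have "words B s" using exec_words[OF init(1) _ w] B n by simp
    with z init(3) have "holds {} z" by (auto simp: holds_def)
    moreover have "mem z x = of_bool (M (x div n) (x mod n))" if "x < n * n" for x
      using that z by (simp add: frame_def omv_start_def)
    ultimately have rd: "ready (prep_set 0) n z"
      using z by (simp add: ready_def frame_def prep_set_def)
    show "wp B' (for_to 10 (prep_body create)) z t ?R"
    proof (rule wp_for_to[where m = "n * n" and I = "\<lambda>p. ready (prep_set p) n" and C = "4 * U + 20"])
      show "n * n < B'" "1 < B'" by (rule small_linear(2) small_linear(1), simp)+
      show "wp B' (prep_body create) s t
          (\<lambda>s' t'. ready (prep_set (Suc p)) n s' \<and> reg s' 4 = p \<and> t' \<le> t + (4 * U + 20))"
        if "p < n * n" "ready (prep_set p) n s" "reg s 4 = p" for p s t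
        using wp_prep_body that by blast
      show "?R z' t'" if "ready (prep_set (n * n)) n z'" "t' \<le> t + n * n * (4 * U + 20 + 3) + 3" for z' t'
      proof -
        have "4 * U + 20 + 3 = 4 * U + 23" by simp
        then have "t' \<le> t + n * n * (4 * U + 23) + 3" using that(2) by (simp only:)
        then have "t' \<le> 2 * P + n * n * (4 * U + 23) + 10" using z init(2) by linarith
        then show ?thesis using that(1) by (simp add: prep_set_full)
      qed
      show "reg s 3 = 1 \<and> reg s 10 = n * n" if "ready (prep_set p) n s" for p s
        using that by (simp add: ready_def)
    qed (use rd in simp_all)
  qed
  moreover have "n * n < B'" "n * n + n < B'" "n * n + n + n < B'" "n < B'"
    by (rule small_linear(2), simp)+
  moreover have "n + n < B'" "n + n + (n + n) < B'" "1 < B'"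
    by (rule small_linear(1), simp)+
  ultimately show ?thesis
    by (simp add: omv_prep_def omv_start_def start_def fun_upd_twist numeral_eq_Suc)
qed

end


section \<open>Running time\<close>

lemma exec_mono: "exec B c s t s' \<Longrightarrow> B \<le> B' \<Longrightarrow> exec B' c s t s'"
proof (induction rule: exec.induct)
  case (Seq c1 s t1 s1 c2 t2 s2)
  then show ?case by (blast intro: exec.Seq)
next
  case (CondTrue s a c1 t s' c2)
  then show ?case by (blast intro: exec.CondTrue)
next
  case (CondFalse s a c2 t s' c1)
  then show ?case by (blast intro: exec.CondFalse)
next
  case (WhileTrue s a c t1 s1 t2 s2)
  then show ?case by (blast intro: exec.WhileTrue)
qed (rule exec.intros; linarith)+

lemma serves_mono:
  assumes "B \<le> B'"
  shows "serves B n create query U Q ops s S \<Longrightarrow> serves B' n create query U Q ops s S"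
proof (induction ops arbitrary: s S)
  case (Cons op ops)
  show ?case
  proof (cases op)
    case (Create up t)
    obtain u v where up: "up = Insert u v" by (cases up)
    show ?thesis
      using Cons unfolding Create up serves.simps by (meson exec_mono[OF _ assms])
  next
    case (Query t)
    show ?thesis
      using Cons unfolding Query serves.simps by (meson exec_mono[OF _ assms])
  qed
qed simp

section \<open>Growth rates\<close>

lemma bigo_compose_linear:
  fixes f :: "nat \<Rightarrow> nat"
  assumes "(\<lambda>n. real (f n)) \<in> O(\<lambda>n. real n powr a)" "a \<le> b"
  shows "(\<lambda>n. real (f (4 * n))) \<in> O(\<lambda>n. real n powr b)"
proof -
  have "filterlim (\<lambda>n::nat. 4 * n) at_top at_top"
    by (rule filterlim_subseq) (simp add: strict_mono_def)
  then have "(\<lambda>n. real (f (4 * n))) \<in> O(\<lambda>n. real (4 * n) powr a)"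
    by (rule landau_o.big.compose[OF assms(1)])
  also have "(\<lambda>n. real (4 * n) powr a) \<in> O(\<lambda>n. real n powr b)"
  proof (rule bigoI)
    show "\<forall>\<^sub>F n in at_top. norm (real (4 * n) powr a) \<le> 4 powr a * norm (real n powr b)"
      using eventually_ge_at_top[of 1]
    proof eventually_elim
      case (elim n)
      then have "real n powr a \<le> real n powr b" using assms(2) by (intro powr_mono) auto
      then show ?case by (simp add: powr_mult mult_left_mono)
    qed
  qed
  finally show ?thesis .
qed

lemma square_times_bigo:
  assumes "(\<lambda>n. real (f n)) \<in> O(\<lambda>n. real n powr (1 - e))"
  shows "(\<lambda>n. real (n * n) * real (f n)) \<in> O(\<lambda>n. real n powr (3 - e))"
proof -
  have "real (n * n) * real n powr (1 - e) = real n powr (3 - e)" for n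
  proof (cases "n = 0")
    case False
    have "real n powr (3 - e) = real n powr (2 + (1 - e))" by simp
    also have "\<dots> = real n powr 2 * real n powr (1 - e)" by (rule powr_add)
    finally show ?thesis using False by (simp add: power2_eq_square)
  qed simp
  moreover have "(\<lambda>n. real (n * n) * real (f n)) \<in> O(\<lambda>n. real (n * n) * real n powr (1 - e))"
    using assms by (intro landau_o.big.mult_left)
  ultimately show ?thesis by simp
qed

text \<open>As \<open>4 * n + 2\<close> is at most \<open>(n + 2) ^ 3\<close>, words of the
  structure fit below \<open>X\<close>. The additional factor \<open>Y\<close> is at least
  \<open>16 * (n + 2) ^ 2\<close> and covers the quadratic terms.\<close>

lemma word_bound_reduction:
  fixes k n :: nat
  defines "B \<equiv> word_bound (Suc k) (4 * n)" and "B' \<equiv> word_bound (3 * Suc k + 6) n"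
  shows "4 * n < B" "B + (n * n + 2 * n) \<le> B'" "5 * (n * n) + 5 * n + 5 \<le> B'"
proof -
  define X where "X = (n + 2) ^ (3 * Suc k)"
  define Y where "Y = (n + 2) ^ 6"
  have "1 \<le> (4 * n + 2) ^ k" by simp
  then have "(4 * n + 2) * 1 \<le> (4 * n + 2) * (4 * n + 2) ^ k" by (intro mult_le_mono2)
  then show "4 * n < B" by (simp add: B_def word_bound_def)
  have "4 * n + 2 \<le> (n + 2) ^ 3" by (simp add: power3_eq_cube algebra_simps)
  then have "(4 * n + 2) ^ Suc k \<le> ((n + 2) ^ 3) ^ Suc k" by (rule power_mono) simp
  then have BX: "B \<le> X" by (simp only: B_def X_def word_bound_def power_mult)
  have "(2::nat) ^ 4 \<le> (n + 2) ^ 4" by (rule power_mono) simp_all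
  then have "(n + 2) ^ 2 * 16 \<le> (n + 2) ^ 2 * (n + 2) ^ 4" by (intro mult_le_mono2) simp
  also have "\<dots> = Y" by (simp add: Y_def flip: power_add)
  finally have Y: "5 * (n * n) + 5 * n + 6 \<le> Y" by (simp add: power2_eq_square algebra_simps)
  have "1 \<le> X" by (simp add: X_def)
  \<comment> \<open>For positive factors the product is at least the sum minus 1, which turns
    additive room into a product of powers.\<close>
  then obtain x y where "X = Suc x" "Y = Suc y" using Y by (metis Suc_le_D add_leD2 le_trans one_le_numeral One_nat_def)
  then have "X + Y \<le> X * Y + 1" by simp
  moreover have "B' = X * Y" by (simp add: B'_def word_bound_def X_def Y_def flip: power_add)
  ultimately show "B + (n * n + 2 * n) \<le> B'" "5 * (n * n) + 5 * n + 5 \<le> B'"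
    using BX Y \<open>1 \<le> X\<close> by linarith+
qed

definition reduction_time :: "(nat \<Rightarrow> nat) \<Rightarrow> (nat \<Rightarrow> nat) \<Rightarrow> (nat \<Rightarrow> nat) \<Rightarrow> nat \<Rightarrow> nat" where
  "reduction_time P U Q n = 2 * P (4 * n) + n * n * (4 * U (4 * n) + 23) + 10 +
     n * (n * (4 * U (4 * n) + 2 * Q (4 * n) + 54) + 10)"

lemma solves_OMv_reduction:
  assumes "retroactive_max_degree init create query P U Q"
  shows "solves_OMv (omv_prep init create) (omv_answer create query) (reduction_time P U Q)"
proof -
  obtain k where k: "\<And>n. n \<ge> 1 \<Longrightarrow> \<exists>d s. exec (word_bound k n) init (start n) d s \<and> d \<le> P n \<and>
       (\<forall>ops. serves (word_bound k n) n create query (U n) (Q n) ops s {})"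
    using assms unfolding retroactive_max_degree_def by blast
  show ?thesis
    unfolding solves_OMv_def
  proof (rule exI[of _ "3 * Suc k + 6"], intro allI impI)
    fix n :: nat and M and vs :: "(nat \<Rightarrow> bool) list"
    assume n: "1 \<le> n" and vs: "length vs = n"
    let ?B = "word_bound (Suc k) (4 * n)" and ?B' = "word_bound (3 * Suc k + 6) n"
    interpret reduction n ?B ?B' "U (4 * n)" "Q (4 * n)" create query M
      using n word_bound_reduction by unfold_locales
    \<comment> \<open>Raising the exponent by one ensures \<open>4 * n < ?B\<close> even for
      \<open>k = 0\<close>.\<close>
    have "word_bound k (4 * n) \<le> ?B" by (simp add: word_bound_def)
    moreover have "1 \<le> 4 * n" using n by simp
    ultimately obtain x s where s: "exec ?B init (start (4 * n)) x s" "x \<le> P (4 * n)" "good s {}"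
      using k[of "4 * n"] unfolding good_def by (meson exec_mono serves_mono)
    obtain t z where z: "exec ?B' (omv_prep init create) (omv_start n M) t z"
      "ready (filled n n) n z" "t \<le> 2 * P (4 * n) + n * n * (4 * U (4 * n) + 23) + 10"
      using wp_prep[OF s] unfolding wp_def by auto
    have "omv_rounds ?B' n M (omv_answer create query) (reduction_time P U Q n - t) vs z"
      by (rule omv_rounds_answer[where r = 0]) (use z vs in \<open>auto simp: reduction_time_def\<close>)
    moreover have "t \<le> reduction_time P U Q n" using z(3) by (simp add: reduction_time_def)
    ultimately show "\<exists>t s. exec ?B' (omv_prep init create) (omv_start n M) t s \<and>
        t \<le> reduction_time P U Q n \<and>
        omv_rounds ?B' n M (omv_answer create query) (reduction_time P U Q n - t) vs s"
      using z(1) by blast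
  qed
qed

lemma reduction_time_bigo:
  assumes P: "(\<lambda>n. real (P n)) \<in> O(\<lambda>n. real n powr (3 - \<delta>))"
    and U: "(\<lambda>n. real (U n)) \<in> O(\<lambda>n. real n powr (1 - \<epsilon>))"
    and Q: "(\<lambda>n. real (Q n)) \<in> O(\<lambda>n. real n powr (1 - \<epsilon>))"
    and e: "e \<le> \<delta>" "e \<le> \<epsilon>" "e \<le> 1"
  shows "(\<lambda>n. real (reduction_time P U Q n)) \<in> O(\<lambda>n. real n powr (3 - e))"
proof -
  \<comment> \<open>Preparation and the \<open>n\<close> rounds each contribute 4 to the coefficient
    8 of the update time, and 77 is 23 + 54.\<close>
  have eq: "real (reduction_time P U Q n) = 2 * real (P (4 * n)) +
      8 * (real (n * n) * real (U (4 * n))) + 2 * (real (n * n) * real (Q (4 * n))) +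
      (77 * real n ^ 2 + 10 * real n + 10)" for n
    by (simp add: reduction_time_def algebra_simps power2_eq_square)
  have "(\<lambda>n. 77 * real n ^ 2 + 10 * real n + 10) \<in> O(\<lambda>n. real n powr (3 - e))"
  proof (rule bigoI)
    show "\<forall>\<^sub>F n in at_top. norm (77 * real n ^ 2 + 10 * real n + 10) \<le> 97 * norm (real n powr (3 - e))"
      using eventually_ge_at_top[of 1]
    proof eventually_elim
      case (elim n)
      have "real n ^ 2 = real n powr 2" using elim by simp
      also have "\<dots> \<le> real n powr (3 - e)" using elim e by (intro powr_mono) auto
      finally have "real n ^ 2 \<le> real n powr (3 - e)" .
      moreover have "real n \<le> real n ^ 2" "1 \<le> real n ^ 2"
        using elim by (auto intro: self_le_power one_le_power)
      ultimately have "77 * real n ^ 2 + 10 * real n + 10 \<le> 97 * real n powr (3 - e)"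
        by linarith
      then show ?case by simp
    qed
  qed
  moreover have "(\<lambda>n. real (P (4 * n))) \<in> O(\<lambda>n. real n powr (3 - e))"
    using P e by (intro bigo_compose_linear) auto
  moreover have "(\<lambda>n. real (n * n) * real (U (4 * n))) \<in> O(\<lambda>n. real n powr (3 - e))"
    "(\<lambda>n. real (n * n) * real (Q (4 * n))) \<in> O(\<lambda>n. real n powr (3 - e))"
    using e by (intro square_times_bigo bigo_compose_linear[OF U] bigo_compose_linear[OF Q]; linarith)+
  ultimately show ?thesis
    unfolding eq by (intro sum_in_bigo(1)[OF sum_in_bigo(1)[OF sum_in_bigo(1)]]) simp_all
qed

theorem theorem9:
  fixes \<epsilon> :: real
  assumes "OMv_conjecture"
    and "\<epsilon> > 0"
  shows "\<not> (\<exists>init create query P U Q.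
            retroactive_max_degree init create query P U Q
          \<and> (\<exists>\<delta>>0. (\<lambda>n. real (P n)) \<in> O(\<lambda>n. real n powr (3 - \<delta>)))
          \<and> (\<lambda>n. real (U n)) \<in> O(\<lambda>n. real n powr (1 - \<epsilon>))
          \<and> (\<lambda>n. real (Q n)) \<in> O(\<lambda>n. real n powr (1 - \<epsilon>)))"
proof clarify
  fix init create query P U Q and \<delta> :: real
  assume r: "retroactive_max_degree init create query P U Q" and "\<delta> > 0"
    and P: "(\<lambda>n. real (P n)) \<in> O(\<lambda>n. real n powr (3 - \<delta>))"
    and U: "(\<lambda>n. real (U n)) \<in> O(\<lambda>n. real n powr (1 - \<epsilon>))"
    and Q: "(\<lambda>n. real (Q n)) \<in> O(\<lambda>n. real n powr (1 - \<epsilon>))"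
  \<comment> \<open>The weakest of the savings counts; the cap at 1 lets the quadratic overhead fit
    into the exponent \<open>3 - e\<close>.\<close>
  define e where "e = min \<delta> (min \<epsilon> 1)"
  have "e > 0" using \<open>\<delta> > 0\<close> assms(2) by (simp add: e_def)
  moreover have "(\<lambda>n. real (reduction_time P U Q n)) \<in> O(\<lambda>n. real n powr (3 - e))"
    by (rule reduction_time_bigo[OF P U Q]) (simp_all add: e_def)
  ultimately show False
    using assms(1) solves_OMv_reduction[OF r] unfolding OMv_conjecture_def by blast
qed

end
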